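(* Let $d\ge 1$ and, for each integer $L\ge 0$, let $\mathcal{Z}(L)=\{z_{L1},\dots,z_{L,\pi_L}\}\subset\mathbb{S}^d$ be a set of Fekete points of degree $L$ for $\mathbb{S}^d$. Given $\varepsilon>0$, let $L_\varepsilon=[(1+\varepsilon)L]$ and $$\mathcal{Z}_\varepsilon(L)=\mathcal{Z}(L_\varepsilon)=\{z_{L_\varepsilon,1},\dots,z_{L_\varepsilon,\pi_{L_\varepsilon}}\}.$$ Then the array $\mathcal{Z}_\varepsilon=\{\mathcal{Z}_\varepsilon(L)\}_{L\ge 0}$ is an $L^p$-Marcinkiewicz-Zygmund array for every $1\le p\le\infty$.
   Context: $\mathbb{S}^d$ is the unit sphere in $\mathbb{R}^{d+1}$ and $\sigma$ is its Lebesgue surface measure; $[x]$ is the integer part of $x$. $\Pi_L$ is the space of spherical harmonics of degree not exceeding $L$ on $\mathbb{S}^d$ (equivalently, the restrictions to $\mathbb{S}^d$ of polynomials in $d+1$ variables of degree at most $L$), and $\pi_L=\dim\Pi_L=\frac{d+2L}{d}\binom{d+L-1}{L}$. Fekete points: let $\{Q_1^L,\dots,Q_{\pi_L}^L\}$ be any basis of $\Pi_L$. A set of Fekete points of degree $L$ for $\mathbb{S}^d$ is a set of points $\{z_{L1},\dots,z_{L,\pi_L}\}\subset\mathbb{S}^d$ such that $(z_{L1},\dots,z_{L,\pi_L})$ maximizes $|\Delta(x_1,\dots,x_{\pi_L})|=|\det(Q_i^L(x_j))_{i,j}|$ over all $(x_1,\dots,x_{\pi_L})\in(\mathbb{S}^d)^{\pi_L}$.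 (This does not depend on the choice of basis.) Triangular array: a family $\mathcal{Z}=\{\mathcal{Z}(L)\}_{L\ge 0}$ of finite sets $\mathcal{Z}(L)=\{z_{Lj}\in\mathbb{S}^d:1\le j\le m_L\}$ with $m_L\to\infty$ as $L\to\infty$. Marcinkiewicz-Zygmund array: a triangular array $\mathcal{Z}$ with $m_L\ge\pi_L$ for all $L$ is an $L^p$-Marcinkiewicz-Zygmund ($L^p$-MZ) array if there is a constant $C_p>0$ such that for all $L\ge 0$ and all $Q\in\Pi_L$, $$\frac{C_p^{-1}}{\pi_L}\sum_{j=1}^{m_L}|Q(z_{Lj})|^p\le\int_{\mathbb{S}^d}|Q(\omega)|^p\,d\sigma(\omega)\le\frac{C_p}{\pi_L}\sum_{j=1}^{m_L}|Q(z_{Lj})|^p$$ if $1\le p<\infty$, and, if $p=\infty$, there is a constant $C>0$ such that for all $L\ge 0$ and $Q\in\Pi_L$, $\sup_{\omega\in\mathbb{S}^d}|Q(\omega)|\le C\sup_{1\le j\le m_L}|Q(z_{Lj})|$. Here, for the array $\mathcal{Z}_\varepsilon$, the $L$-th generation is $\mathcal{Z}(L_\varepsilon)$, so $m_L=\pi_{L_\varepsilon}$. *)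

theory Defs
  imports
    "HOL-Analysis.Analysis"
    "HOL-Library.Function_Algebras"
    "Jordan_Normal_Form.Determinant"
begin

text \<open>
  Pointwise real vector space structure on functions, so that the library's \<open>span\<close>,
  \<open>independent\<close> and \<open>dim\<close> apply to spaces of real-valued functions.
\<close>

instantiation "fun" :: (type, real_vector) real_vector
begin

definition scaleR_fun_def: "c *\<^sub>R f = (\<lambda>x. c *\<^sub>R f x)"

instance
  by standard (simp_all add: scaleR_fun_def plus_fun_def scaleR_add_right scaleR_add_left)

end

text \<open>
  Throughout, the ambient space is \<open>real ^ 'n\<close> with \<open>CARD('n) = d + 1\<close>, and the sphere
  \<open>S\<^sup>d\<close> is \<open>sphere 0 1\<close>.

  Surface measure: in polar coordinates \<open>dx = r\<^sup>d dr d\<sigma>\<close>, so the cone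
  \<open>{r x | 0 < r < 1, x \<in> A}\<close> over \<open>A\<close> has volume \<open>\<sigma>(A) / (d + 1)\<close>. This determines the
  (unnormalised) measure \<open>\<sigma>\<close>, see \<open>emeasure_surface_measure\<close> below.
\<close>

definition surface_measure :: "(real ^ 'n) measure" where
  "surface_measure =
     distr (scale_measure (of_nat CARD('n)) (restrict_space lborel (ball 0 1 - {0})))
       (restrict_space borel (sphere 0 1)) (\<lambda>x. x /\<^sub>R norm x)"

lemma emeasure_surface_measure:
  fixes A :: "(real ^ 'n) set"
  assumes A: "A \<in> sets borel" "A \<subseteq> sphere 0 1"
  shows "emeasure surface_measure A =
    of_nat CARD('n) * emeasure lborel {r *\<^sub>R x | r x. 0 < r \<and> r < 1 \<and> x \<in> A}"
proof -
  let ?B = "ball 0 1 - {0 :: real ^ 'n}"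
  let ?M = "scale_measure (of_nat CARD('n)) (restrict_space lborel ?B)"
  let ?S = "restrict_space borel (sphere 0 (1 :: real)) :: (real ^ 'n) measure"
  let ?f = "\<lambda>x :: real ^ 'n. x /\<^sub>R norm x"
  have f: "?f \<in> ?M \<rightarrow>\<^sub>M ?S"
  proof (rule measurable_restrict_space2)
    have "?f \<in> restrict_space lborel ?B \<rightarrow>\<^sub>M borel"
      by (rule measurable_restrict_space1) measurable
    then show "?f \<in> ?M \<rightarrow>\<^sub>M borel"
      by (simp add: measurable_def space_scale_measure)
  qed (auto simp: space_restrict_space space_scale_measure)
  have cone: "?f -` A \<inter> ?B = {r *\<^sub>R x | r x. 0 < r \<and> r < 1 \<and> x \<in> A}"
  proof (intro subset_antisym subsetI)
    fix y assume y: "y \<in> ?f -` A \<inter> ?B"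
    then have "y = norm y *\<^sub>R ?f y" "0 < norm y" "norm y < 1" "?f y \<in> A" by auto
    then show "y \<in> {r *\<^sub>R x | r x. 0 < r \<and> r < 1 \<and> x \<in> A}" by blast
  next
    fix y assume "y \<in> {r *\<^sub>R x | r x. 0 < r \<and> r < 1 \<and> x \<in> A}"
    then obtain r x where "y = r *\<^sub>R x" "0 < r" "r < 1" "x \<in> A" "norm x = 1"
      using A(2) by auto
    then show "y \<in> ?f -` A \<inter> ?B" by auto
  qed
  have "A \<in> sets ?S" using A by (subst sets_restrict_space_iff) auto
  then have "emeasure surface_measure A = emeasure ?M (?f -` A \<inter> ?B)"
    unfolding surface_measure_def using f
    by (subst emeasure_distr) (auto simp: space_restrict_space space_scale_measure)
  also have "\<dots> = of_nat CARD('n) * emeasure lborel (?f -` A \<inter> ?B)"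
    by (subst emeasure_scale_measure, subst emeasure_restrict_space) auto
  finally show ?thesis by (simp only: cone)
qed

text \<open>
  \<open>\<Pi>\<^sub>L\<close>: restrictions to the sphere of real polynomials of degree at most \<open>L\<close>. A function on
  the sphere is represented by its extension by zero to the whole space, so two polynomials
  that agree on the sphere give the same element.
\<close>

definition sph_poly :: "nat \<Rightarrow> (real ^ 'n \<Rightarrow> real) set" where
  "sph_poly L = span {(\<lambda>x. if x \<in> sphere 0 1 then \<Prod>i\<in>UNIV. (x $ i) ^ \<alpha> i else 0) | \<alpha> :: 'n \<Rightarrow> nat.
     (\<Sum>i\<in>UNIV. \<alpha> i) \<le> L}"

definition sph_dim :: "'n :: finite itself \<Rightarrow> nat \<Rightarrow> nat" where
  "sph_dim _ L = dim (sph_poly L :: (real ^ 'n \<Rightarrow> real) set)"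

text \<open>Finite families are indexed from \<open>0\<close>: \<open>j < m\<close> instead of \<open>1 \<le> j \<le> m\<close>.\<close>

definition sph_basis :: "nat \<Rightarrow> (nat \<Rightarrow> real ^ 'n \<Rightarrow> real) \<Rightarrow> bool" where
  "sph_basis L Q \<longleftrightarrow> inj_on Q {..<sph_dim TYPE('n) L} \<and>
     independent (Q ` {..<sph_dim TYPE('n) L}) \<and> span (Q ` {..<sph_dim TYPE('n) L}) = sph_poly L"

definition fekete_det :: "nat \<Rightarrow> (nat \<Rightarrow> real ^ 'n \<Rightarrow> real) \<Rightarrow> (nat \<Rightarrow> real ^ 'n) \<Rightarrow> real" where
  "fekete_det L Q x =
     Determinant.det
       (Matrix.mat (sph_dim TYPE('n) L) (sph_dim TYPE('n) L) (\<lambda>(i, j). Q i (x j)))"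

text \<open>
  A change of basis multiplies all determinants by the same nonzero constant, so ``for some
  basis'' and ``for every basis'' are equivalent here.
\<close>

definition fekete_points :: "nat \<Rightarrow> (nat \<Rightarrow> real ^ 'n) \<Rightarrow> bool" where
  "fekete_points L z \<longleftrightarrow>
     (\<forall>j < sph_dim TYPE('n) L. z j \<in> sphere 0 1) \<and>
     (\<exists>Q. sph_basis L Q \<and>
       (\<forall>x. (\<forall>j < sph_dim TYPE('n) L. x j \<in> sphere 0 1) \<longrightarrow>
         \<bar>fekete_det L Q x\<bar> \<le> \<bar>fekete_det L Q z\<bar>))"

text \<open>
  The generation of index \<open>L\<close> is the set of the \<open>m L\<close> points \<open>z L j\<close>, \<open>j < m L\<close>; injectivity
  says that it really has \<open>m L\<close> elements.
\<close>

definition triangular_array :: "(nat \<Rightarrow> nat) \<Rightarrow> (nat \<Rightarrow> nat \<Rightarrow> real ^ 'n) \<Rightarrow> bool" where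
  "triangular_array m z \<longleftrightarrow>
     (\<forall>L. inj_on (z L) {..<m L} \<and> z L ` {..<m L} \<subseteq> sphere 0 1) \<and>
     filterlim m at_top sequentially"

definition MZ_array :: "ennreal \<Rightarrow> (nat \<Rightarrow> nat) \<Rightarrow> (nat \<Rightarrow> nat \<Rightarrow> real ^ 'n) \<Rightarrow> bool" where
  "MZ_array p m z \<longleftrightarrow>
     triangular_array m z \<and> (\<forall>L. sph_dim TYPE('n) L \<le> m L) \<and>
     (if p = \<infinity> then
        \<exists>C>0. \<forall>L. \<forall>Q \<in> sph_poly L.
          (SUP \<omega>\<in>sphere 0 1. \<bar>Q \<omega>\<bar>) \<le> C * (SUP j\<in>{..<m L}. \<bar>Q (z L j)\<bar>)
      else
        \<exists>C>0. \<forall>L. \<forall>Q \<in> sph_poly L.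
          inverse C / real (sph_dim TYPE('n) L) * (\<Sum>j<m L. \<bar>Q (z L j)\<bar> powr enn2real p)
            \<le> (\<integral>\<omega>. \<bar>Q \<omega>\<bar> powr enn2real p \<partial>surface_measure) \<and>
          (\<integral>\<omega>. \<bar>Q \<omega>\<bar> powr enn2real p \<partial>surface_measure)
            \<le> C / real (sph_dim TYPE('n) L) * (\<Sum>j<m L. \<bar>Q (z L j)\<bar> powr enn2real p))"

definition L_eps :: "real \<Rightarrow> nat \<Rightarrow> nat" where
  "L_eps \<epsilon> L = nat \<lfloor>(1 + \<epsilon>) * real L\<rfloor>"

end

theory Submission
  imports Defs "HOL-Complex_Analysis.Complex_Analysis"
begin

text \<open>
  Let \<open>z\<^sub>1, z\<^sub>2, \<dots>\<close> be Fekete points of degree \<open>M\<close>. Maximality of the determinant says that the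
  Lagrange polynomials \<open>l\<^sub>j\<close> of these points are bounded by \<open>1\<close> on the sphere
  (\<open>fekete_lagrange\<close>). Everything follows from this bound together with one family of kernels.

  First, \<open>l\<^sub>j\<close> has degree \<open>M\<close>, equals \<open>1\<close> at \<open>z\<^sub>j\<close> and \<open>0\<close> at the other points, so a Bernstein-type
  inequality (\<open>sph_poly_lipschitz\<close>) shows that the points are separated by a multiple of
  \<open>1/(M + 1)\<close> (\<open>fekete_separated\<close>). Hence sums over the points of a weight that decays away from a
  centre at scale \<open>1/n\<close>, with \<open>n \<le> M + 1\<close>, are controlled by its integral over the sphere
  (\<open>sum_decay_separated_le\<close>, \<open>integral_decay_le\<close>).

  Secondly, a power of the Dirichlet kernel gives for each \<open>w\<close> a polynomial \<open>q\<close> of degree at most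
  \<open>m\<close> with \<open>q(w) = 1\<close> that decays at scale \<open>1/(m + 1)\<close> away from \<open>w\<close> (\<open>localised_kernel\<close>). If \<open>f\<close> has
  degree \<open>L \<le> M\<close>, then \<open>f q\<close> has degree at most \<open>M\<close> for \<open>m = M - L\<close>: the excess of the degree of
  the Fekete points over that of \<open>f\<close> pays for the localisation. Interpolating \<open>f q\<close> at the \<open>z\<^sub>j\<close>
  and evaluating at \<open>w\<close> gives
    \<open>|f(w)| \<le> \<Sum>\<^sub>j |f(z\<^sub>j)| |q(z\<^sub>j)|\<close>  (\<open>sph_poly_le_local_sum\<close>),
  and the elementary \<open>L\<^sup>1\<close>--\<open>L\<^sup>\<infinity>\<close> inequality \<open>sph_poly_sup_le_integral\<close> applied to \<open>f q\<close> gives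
    \<open>|f(w)| \<le> C (M + 1)\<^sup>d \<integral>|f| |q| d\<sigma>\<close>  (\<open>sph_poly_le_local_mean\<close>).
  When \<open>M - L\<close> is at least a fixed proportion of \<open>M\<close>, the weights in both estimates have bounded
  total mass, and Jensen's inequality followed by integration over \<open>w\<close>, respectively summation
  over \<open>w = z\<^sub>j\<close>, yields the two halves of the Marcinkiewicz-Zygmund inequality with the factor
  \<open>(M + 1)\<^sup>d\<close> in place of the dimension.

  That \<open>dim \<Pi>\<^sub>M\<close> is of order \<open>(M + 1)\<^sup>d\<close> comes out of the same estimates, because it is the number
  of Fekete points: separation bounds it from above (\<open>sph_dim_upper\<close>), and reproduction of the
  constant \<open>1\<close> bounds it from below (\<open>sph_dim_lower\<close>).
\<close>

text \<open>In what follows \<open>$\<close> stands for the components of a vector in \<open>real ^ 'n\<close> only.\<close>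

no_notation fps_nth (infixl "$" 75)
no_notation vec_index (infixl "$" 100)

section \<open>The spaces of spherical polynomials\<close>

lemma subspace_sph_poly: "subspace (sph_poly L)"
  unfolding sph_poly_def by (rule subspace_span)

lemma sph_poly_mono: "L \<le> M \<Longrightarrow> sph_poly L \<subseteq> sph_poly M"
  unfolding sph_poly_def by (rule span_mono) force

lemma sph_poly_zero: "(\<lambda>x. 0) \<in> sph_poly L"
  using subspace_0[OF subspace_sph_poly] by (simp add: zero_fun_def)

lemma sph_poly_add:
  "f \<in> sph_poly L \<Longrightarrow> g \<in> sph_poly L \<Longrightarrow> (\<lambda>x. f x + g x) \<in> sph_poly L"
  using subspace_add[OF subspace_sph_poly, of f L g] by (simp add: plus_fun_def)

lemma sph_poly_scale: "f \<in> sph_poly L \<Longrightarrow> (\<lambda>x. c * f x) \<in> sph_poly L"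
  using subspace_scale[OF subspace_sph_poly, of f L c] by (simp add: scaleR_fun_def)

lemma sph_poly_sum:
  "(\<And>i. i \<in> I \<Longrightarrow> f i \<in> sph_poly L) \<Longrightarrow> (\<lambda>x. \<Sum>i\<in>I. c i * f i x) \<in> sph_poly L"
  by (induction I rule: infinite_finite_induct)
     (auto simp: sph_poly_zero intro!: sph_poly_add sph_poly_scale)

lemma sph_poly_monom:
  "(\<Sum>i\<in>UNIV. \<alpha> i) \<le> L \<Longrightarrow>
    (\<lambda>x. if x \<in> sphere 0 1 then \<Prod>i\<in>UNIV. (x $ i) ^ \<alpha> i else 0) \<in> sph_poly L"
  unfolding sph_poly_def by (intro span_base) blast

lemma sph_poly_induct [consumes 1, case_names zero monom add scale]:
  fixes P :: "(real ^ 'n \<Rightarrow> real) \<Rightarrow> bool"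
  assumes "f \<in> sph_poly L"
    and "P (\<lambda>x. 0)"
    and "\<And>\<alpha>. (\<Sum>i\<in>UNIV. \<alpha> i) \<le> L \<Longrightarrow>
      P (\<lambda>x. if x \<in> sphere 0 1 then \<Prod>i\<in>UNIV. (x $ i) ^ \<alpha> i else 0)"
    and "\<And>f g. P f \<Longrightarrow> P g \<Longrightarrow> P (\<lambda>x. f x + g x)"
    and "\<And>c f. P f \<Longrightarrow> P (\<lambda>x. c * f x)"
  shows "P f"
proof -
  have "subspace (Collect P)"
    using assms(2,4,5) by (auto simp: subspace_def zero_fun_def plus_fun_def scaleR_fun_def)
  moreover have "{(\<lambda>x :: real ^ 'n. if x \<in> sphere 0 1 then \<Prod>i\<in>UNIV. (x $ i) ^ \<alpha> i else 0) | \<alpha>.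
      (\<Sum>i\<in>UNIV. \<alpha> i) \<le> L} \<subseteq> Collect P"
    using assms(3) by auto
  ultimately have "sph_poly L \<subseteq> Collect P"
    unfolding sph_poly_def by (rule span_minimal[rotated])
  with assms(1) show ?thesis by auto
qed

lemma sph_poly_outside: "f \<in> sph_poly L \<Longrightarrow> x \<notin> sphere 0 1 \<Longrightarrow> f x = 0"
  by (induction f rule: sph_poly_induct) auto

lemma sph_poly_const: "(\<lambda>x. if x \<in> sphere 0 1 then c else 0) \<in> sph_poly L"
proof -
  have "(\<lambda>x. c * (if x \<in> sphere 0 1 then \<Prod>i\<in>UNIV. (x $ i) ^ 0 else 0)) \<in> sph_poly L"
    by (intro sph_poly_scale sph_poly_monom) simp
  then show ?thesis
    by (rule back_subst[where P = "\<lambda>f. f \<in> sph_poly L"]) auto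
qed

lemma sph_poly_inner:
  fixes w :: "real ^ 'n"
  shows "(\<lambda>x. if x \<in> sphere 0 1 then inner x w else 0) \<in> sph_poly 1"
proof -
  define \<delta> :: "'n \<Rightarrow> 'n \<Rightarrow> nat" where "\<delta> i k = (if k = i then 1 else 0)" for i k
  have lin: "(\<lambda>x. \<Sum>i\<in>UNIV. w $ i * (if x \<in> sphere 0 1 then \<Prod>k\<in>UNIV. (x $ k) ^ \<delta> i k else 0))
      \<in> sph_poly 1"
    by (intro sph_poly_sum sph_poly_monom) (simp add: \<delta>_def)
  have [simp]: "(\<Prod>k\<in>UNIV. (x $ k) ^ \<delta> i k) = x $ i" for x :: "real ^ 'n" and i
  proof -
    have "(\<Prod>k\<in>UNIV. (x $ k) ^ \<delta> i k) = (\<Prod>k\<in>UNIV. if k = i then x $ k else 1)"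
      by (rule prod.cong) (auto simp: \<delta>_def)
    then show ?thesis by simp
  qed
  from lin show ?thesis
    by (rule back_subst[where P = "\<lambda>f. f \<in> sph_poly 1"])
       (auto simp: inner_vec_def mult.commute)
qed

lemma sph_poly_mult:
  assumes f: "f \<in> sph_poly L" and g: "g \<in> sph_poly M"
  shows "(\<lambda>x. f x * g x) \<in> sph_poly (L + M)"
  using f
proof (induction f rule: sph_poly_induct)
  case zero
  show ?case by (simp add: sph_poly_zero)
next
  case (monom \<alpha>)
  show ?case
    using g
  proof (induction g rule: sph_poly_induct)
    case zero
    show ?case by (simp add: sph_poly_zero)
  next
    case m: (monom \<beta>)
    have "(\<Sum>i\<in>UNIV. \<alpha> i + \<beta> i) \<le> L + M"
      using monom m by (simp add: sum.distrib)
    from sph_poly_monom[OF this] show ?case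
      by (rule back_subst[where P = "\<lambda>f. f \<in> sph_poly (L + M)"])
         (auto simp: power_add prod.distrib)
  next
    case (add g h)
    from sph_poly_add[OF this] show ?case by (simp add: algebra_simps)
  next
    case (scale c g)
    from sph_poly_scale[OF this, of c] show ?case by (simp add: algebra_simps)
  qed
next
  case (add f h)
  from sph_poly_add[OF this] show ?case by (simp add: algebra_simps)
next
  case (scale c f)
  from sph_poly_scale[OF this, of c] show ?case by (simp add: algebra_simps)
qed

lemma sph_poly_power:
  assumes "f \<in> sph_poly L"
  shows "(\<lambda>x. if x \<in> sphere 0 1 then f x ^ k else 0) \<in> sph_poly (k * L)"
proof (induction k)
  case 0
  show ?case using sph_poly_const[of 1 0] by (simp cong: if_cong)
next
  case (Suc k)
  from sph_poly_mult[OF assms Suc] show ?case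
    by (auto simp: if_distrib cong: if_cong)
qed

lemma sph_poly_bounded:
  assumes "f \<in> sph_poly L"
  obtains B where "B \<ge> 0" "\<And>x. \<bar>f x\<bar> \<le> B"
proof -
  have "\<exists>B\<ge>0. \<forall>x. \<bar>f x\<bar> \<le> B"
    using assms
  proof (induction f rule: sph_poly_induct)
    case zero
    show ?case by auto
  next
    case (monom \<alpha>)
    have "\<bar>\<Prod>i\<in>UNIV. (x $ i) ^ \<alpha> i\<bar> \<le> 1" if "norm x = 1" for x :: "real ^ 'a"
    proof -
      have "\<bar>x $ i\<bar> \<le> 1" for i using component_le_norm_cart[of x i] that by simp
      then show ?thesis
        by (auto simp: abs_prod power_abs intro!: prod_le_1 power_le_one)
    qed
    then show ?case by (intro exI[of _ 1]) auto
  next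
    case (add f g)
    then obtain B C where "B \<ge> 0" "\<forall>x. \<bar>f x\<bar> \<le> B" "C \<ge> 0" "\<forall>x. \<bar>g x\<bar> \<le> C" by auto
    then show ?case
      by (intro exI[of _ "B + C"]) (auto intro: order_trans[OF abs_triangle_ineq] add_mono)
  next
    case (scale c f)
    then obtain B where "B \<ge> 0" "\<forall>x. \<bar>f x\<bar> \<le> B" by auto
    then show ?case
      by (intro exI[of _ "\<bar>c\<bar> * B"]) (auto simp: abs_mult intro: mult_left_mono)
  qed
  with that show ?thesis by auto
qed

lemma sph_poly_borel_measurable:
  fixes f :: "real ^ 'n \<Rightarrow> real"
  assumes "f \<in> sph_poly L"
  shows "f \<in> borel_measurable borel"
  using assms
proof (induction f rule: sph_poly_induct)
  case (monom \<alpha>)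
  have "(\<lambda>x :: real ^ 'n. \<Prod>i\<in>UNIV. (x $ i) ^ \<alpha> i) \<in> borel_measurable borel"
    by (intro borel_measurable_continuous_onI continuous_intros)
  then show ?case
    by (intro measurable_If_set) auto
qed auto

section \<open>A Bernstein-type Lipschitz estimate\<close>

text \<open>Apply the maximum principle to the reversed polynomial \<open>w\<^sup>n P(1/w)\<close> on the disc.\<close>

lemma poly_growth_outside_unit_disc:
  fixes p :: "complex poly"
  assumes "\<And>z. norm z = 1 \<Longrightarrow> norm (poly p z) \<le> B" and "norm z \<ge> 1" and "degree p \<le> n"
  shows "norm (poly p z) \<le> B * norm z ^ n"
proof -
  have B: "B \<ge> 0" using order_trans[OF norm_ge_zero assms(1)[of 1]] by simp
  have z: "z \<noteq> 0" using assms(2) by auto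
  have "norm (poly (reflect_poly p) (inverse z)) \<le> B"
  proof (rule maximum_modulus_frontier[where S = "cball 0 1" and f = "poly (reflect_poly p)"])
    show "poly (reflect_poly p) holomorphic_on interior (cball 0 1)"
      by (intro holomorphic_intros)
    show "norm (poly (reflect_poly p) w) \<le> B" if "w \<in> frontier (cball 0 1)" for w
    proof -
      have w: "norm w = 1" using that by (simp add: frontier_cball)
      then have "w \<noteq> 0" by auto
      with w assms(1)[of "inverse w"] show ?thesis
        by (simp add: poly_reflect_poly_nz norm_mult norm_power norm_inverse)
    qed
    show "inverse z \<in> cball 0 1"
      using assms(2) z by (simp add: norm_divide inverse_eq_divide divide_le_eq)
  qed (auto intro!: continuous_intros)
  then have "norm (poly p z) / norm z ^ degree p \<le> B"
    using z by (simp add: poly_reflect_poly_nz norm_mult norm_power norm_divide divide_inverse norm_inverse power_inverse mult.commute)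
  then have "norm (poly p z) \<le> B * norm z ^ degree p"
    using z by (simp add: divide_simps)
  also have "\<dots> \<le> B * norm z ^ n"
    using assms B by (intro mult_left_mono power_increasing)
  finally show ?thesis .
qed

text \<open>
  The circle of radius \<open>1/n\<close> around a point of the unit disc stays inside the disc of radius
  \<open>1 + 1/n\<close>, where \<open>p\<close> is at most \<open>B (1 + 1/n)\<^sup>n \<le> e B\<close>; Cauchy's inequality there bounds \<open>p'\<close>
  by \<open>e n B\<close>.
\<close>

lemma poly_lipschitz_on_unit_disc:
  fixes p :: "complex poly"
  assumes B: "\<And>z. norm z = 1 \<Longrightarrow> norm (poly p z) \<le> B" and n: "degree p \<le> n"
    and a: "norm a \<le> 1" and b: "norm b \<le> 1"
  shows "norm (poly p a - poly p b) \<le> 3 * real n * B * norm (a - b)"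
proof (cases "n = 0")
  case True
  then obtain c where "p = [:c:]" using n degree_eq_zeroE by (metis le_zero_eq)
  then show ?thesis by (simp add: True)
next
  case False
  define r where "r = 1 + 1 / real n"
  have B0: "B \<ge> 0" using order_trans[OF norm_ge_zero B[of 1]] by simp
  have rn: "r ^ n \<le> 3"
  proof -
    have "r ^ n \<le> exp (1 / real n) ^ n"
      unfolding r_def by (intro power_mono) (auto simp: add.commute intro: exp_ge_add_one_self)
    also have "\<dots> = exp 1" using False by (simp flip: exp_of_nat_mult)
    finally show ?thesis using exp_le by simp
  qed
  have growth: "norm (poly p z) \<le> 3 * B" if "norm z \<le> r" for z
  proof (cases "norm z \<ge> 1")
    case True
    have "norm (poly p z) \<le> B * norm z ^ n"
      using poly_growth_outside_unit_disc[OF B True n] .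
    also have "\<dots> \<le> B * r ^ n" using that B0 by (intro mult_left_mono power_mono) auto
    also have "\<dots> \<le> B * 3" using rn B0 by (intro mult_left_mono)
    finally show ?thesis by simp
  next
    case False
    have "norm (poly p z) \<le> B"
    proof (rule maximum_modulus_frontier[where S = "cball 0 1" and f = "poly p"])
      show "norm (poly p w) \<le> B" if "w \<in> frontier (cball 0 1)" for w
        using that B by (simp add: frontier_cball)
    qed (use False in \<open>auto intro!: continuous_intros holomorphic_intros\<close>)
    with B0 show ?thesis by simp
  qed
  have deriv: "norm (poly (pderiv p) z) \<le> 3 * real n * B" if "norm z \<le> 1" for z
  proof -
    have "norm ((deriv ^^ 1) (poly p) z) \<le> fact 1 * (3 * B) / (1 / real n) ^ 1"
    proof (rule Cauchy_inequality)
      show "norm (poly p x) \<le> 3 * B" if "norm (z - x) = 1 / real n" for x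
      proof (rule growth)
        have "norm x \<le> norm z + norm (z - x)"
          by (metis add.commute norm_minus_commute norm_triangle_sub)
        then show "norm x \<le> r" using that \<open>norm z \<le> 1\<close> by (simp add: r_def)
      qed
    qed (use False in \<open>auto intro!: continuous_intros holomorphic_intros\<close>)
    moreover have "deriv (poly p) z = poly (pderiv p) z"
      by (intro DERIV_imp_deriv poly_DERIV)
    ultimately show ?thesis by (simp add: mult_ac)
  qed
  show ?thesis
  proof (rule field_differentiable_bound[where S = "cball 0 1"])
    show "(poly p has_field_derivative poly (pderiv p) z) (at z within cball 0 1)" for z
      by (rule DERIV_subset[OF poly_DERIV]) auto
  qed (use a b deriv in auto)
qed

text \<open>
  On the unit circle \<open>b Re b = (b\<^sup>2 + 1)/2\<close> and \<open>b Im b = (b\<^sup>2 - 1)/(2\<i>)\<close>, so along a great circle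
  parametrised by \<open>b\<close> a spherical polynomial of degree \<open>L\<close>, multiplied by \<open>b\<^sup>L\<close>, becomes an
  algebraic polynomial in \<open>b\<close> of degree \<open>2L\<close>.
\<close>

lemma sph_poly_on_great_circle:
  fixes u v :: "real ^ 'n"
  assumes "f \<in> sph_poly L"
    and S: "\<And>b. norm b = 1 \<Longrightarrow> Re b *\<^sub>R u + Im b *\<^sub>R v \<in> sphere 0 1"
  shows "\<exists>p :: complex poly. degree p \<le> 2 * L \<and>
    (\<forall>b. norm b = 1 \<longrightarrow> poly p b = b ^ L * of_real (f (Re b *\<^sub>R u + Im b *\<^sub>R v)))"
  using assms(1)
proof (induction f rule: sph_poly_induct)
  case zero
  show ?case by (intro exI[of _ 0]) auto
next
  case (monom \<alpha>)
  define k where "k = (\<Sum>i\<in>UNIV. \<alpha> i)"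
  define c where "c i = Complex (u $ i) (v $ i) / 2" for i
  define q where "q i = [: c i, 0, cnj (c i) :]" for i
  define p where "p = Polynomial.monom 1 (L - k) * (\<Prod>i\<in>UNIV. q i ^ \<alpha> i)"
  have "degree (q i) \<le> 2" for i
    by (simp add: q_def degree_pCons_le)
  then have "degree (q i ^ \<alpha> i) \<le> 2 * \<alpha> i" for i
    by (intro order_trans[OF degree_power_le]) auto
  then have "degree (\<Prod>i\<in>UNIV. q i ^ \<alpha> i) \<le> (\<Sum>i\<in>UNIV. 2 * \<alpha> i)"
    by (intro order_trans[OF degree_prod_sum_le] sum_mono) auto
  also have "\<dots> = 2 * k" by (simp add: k_def sum_distrib_left)
  finally have "degree p \<le> (L - k) + 2 * k"
    unfolding p_def by (intro order_trans[OF degree_mult_le] add_mono) (auto simp: degree_monom_le)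
  moreover have "k \<le> L" using monom by (simp add: k_def)
  ultimately have "degree p \<le> 2 * L" by simp
  moreover have "poly p b = b ^ L * of_real (\<Prod>i\<in>UNIV. ((Re b *\<^sub>R u + Im b *\<^sub>R v) $ i) ^ \<alpha> i)"
    if b: "norm b = 1" for b
  proof -
    have q: "poly (q i) b = b * of_real (Re b * u $ i + Im b * v $ i)" for i
    proof -
      have "(Re b)\<^sup>2 + (Im b)\<^sup>2 = 1" using b by (simp add: cmod_def)
      then have bb: "u $ i = ((Re b)\<^sup>2 + (Im b)\<^sup>2) * u $ i" "v $ i = ((Re b)\<^sup>2 + (Im b)\<^sup>2) * v $ i"
        by simp_all
      have "Re (poly (q i) b) = (u $ i + ((Re b)\<^sup>2 - (Im b)\<^sup>2) * u $ i) / 2 + Re b * Im b * v $ i"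
        by (simp add: q_def c_def power2_eq_square field_simps)
      also have "\<dots> = Re (b * of_real (Re b * u $ i + Im b * v $ i))"
        by (subst bb(1)) (simp add: power2_eq_square field_simps)
      finally have "Re (poly (q i) b) = Re (b * of_real (Re b * u $ i + Im b * v $ i))" .
      moreover have "Im (poly (q i) b) = (v $ i - ((Re b)\<^sup>2 - (Im b)\<^sup>2) * v $ i) / 2 + Re b * Im b * u $ i"
        by (simp add: q_def c_def power2_eq_square field_simps)
      moreover have "\<dots> = Im (b * of_real (Re b * u $ i + Im b * v $ i))"
        by (subst bb(2)) (simp add: power2_eq_square field_simps)
      ultimately show ?thesis by (simp add: complex_eq_iff)
    qed
    have "poly p b = b ^ (L - k) * (\<Prod>i\<in>UNIV. (b * of_real (Re b * u $ i + Im b * v $ i)) ^ \<alpha> i)"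
      by (simp add: p_def poly_monom poly_prod q)
    also have "\<dots> = b ^ (L - k) * b ^ k * (\<Prod>i\<in>UNIV. of_real (Re b * u $ i + Im b * v $ i) ^ \<alpha> i)"
      by (simp add: power_mult_distrib prod.distrib k_def power_sum mult_ac)
    also have "b ^ (L - k) * b ^ k = b ^ L" using \<open>k \<le> L\<close> by (simp flip: power_add)
    finally show ?thesis by simp
  qed
  ultimately show ?case using S by (intro exI[of _ p]) auto
next
  case (add f g)
  then obtain p q where "degree p \<le> 2 * L" "degree q \<le> 2 * L"
    "\<forall>b. norm b = 1 \<longrightarrow> poly p b = b ^ L * of_real (f (Re b *\<^sub>R u + Im b *\<^sub>R v))"
    "\<forall>b. norm b = 1 \<longrightarrow> poly q b = b ^ L * of_real (g (Re b *\<^sub>R u + Im b *\<^sub>R v))" by auto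
  then show ?case
    by (intro exI[of _ "p + q"]) (auto simp: algebra_simps degree_add_le)
next
  case (scale c f)
  then obtain p where "degree p \<le> 2 * L"
    "\<forall>b. norm b = 1 \<longrightarrow> poly p b = b ^ L * of_real (f (Re b *\<^sub>R u + Im b *\<^sub>R v))" by auto
  then show ?case
    by (intro exI[of _ "Polynomial.smult (of_real c) p"])
       (auto intro: order_trans[OF degree_smult_le])
qed

text \<open>
  The point \<open>x\<close> is the parameter \<open>b = 1\<close>, and chords of the unit circle have the length of the
  corresponding chords of the sphere. Antipodal points are excluded because they do not determine
  the direction \<open>v\<close>.
\<close>

lemma great_circle_through:
  fixes x y :: "real ^ 'n"
  assumes x: "norm x = 1" and y: "norm y = 1" and xy: "x \<noteq> y" "x \<noteq> - y"
  obtains v b where "\<And>b. norm b = 1 \<Longrightarrow> Re b *\<^sub>R x + Im b *\<^sub>R v \<in> sphere 0 1"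
    "norm b = 1" "y = Re b *\<^sub>R x + Im b *\<^sub>R v" "norm (1 - b) = norm (x - y)"
proof -
  define c where "c = inner x y"
  define w where "w = y - c *\<^sub>R x"
  define s where "s = norm w"
  define v where "v = w /\<^sub>R s"
  have xx: "inner x x = 1" and yy: "inner y y = 1"
    using x y by (simp_all add: dot_square_norm)
  have "w \<noteq> 0"
  proof
    assume "w = 0"
    then have eq: "y = c *\<^sub>R x" by (simp add: w_def)
    then have "\<bar>c\<bar> = 1" using x y by simp
    then show False using eq xy by (auto simp: abs_if split: if_splits)
  qed
  then have s: "s > 0" by (simp add: s_def)
  have s2: "s\<^sup>2 = 1 - c\<^sup>2"
    unfolding s_def power2_norm_eq_inner w_def
    by (simp add: inner_diff_left inner_diff_right xx yy inner_commute[of y x]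
        power2_eq_square flip: c_def)
  have xv: "inner x v = 0"
    by (simp add: v_def w_def inner_diff_right xx flip: c_def)
  have vv: "inner v v = 1"
    using s by (simp add: v_def dot_square_norm s_def power2_eq_square)
  show thesis
  proof
    fix b :: complex assume "norm b = 1"
    then have b: "(Re b)\<^sup>2 + (Im b)\<^sup>2 = 1" by (simp add: cmod_def)
    have "(norm (Re b *\<^sub>R x + Im b *\<^sub>R v))\<^sup>2 = (Re b)\<^sup>2 + (Im b)\<^sup>2"
      unfolding power2_norm_eq_inner
      by (simp add: inner_add_left inner_add_right xx vv xv inner_commute[of v x] power2_eq_square)
    with b show "Re b *\<^sub>R x + Im b *\<^sub>R v \<in> sphere 0 1" by (simp add: power2_eq_1_iff)
         (use norm_ge_zero[of "Re b *\<^sub>R x + Im b *\<^sub>R v"] in linarith)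
  next
    show "norm (Complex c s) = 1" using s2 by (simp add: cmod_def)
    show "y = Re (Complex c s) *\<^sub>R x + Im (Complex c s) *\<^sub>R v"
      using s by (simp add: v_def w_def)
    have "(norm (1 - Complex c s))\<^sup>2 = (norm (x - y))\<^sup>2"
      unfolding power2_norm_eq_inner
      using s2 by (simp add: inner_diff_left inner_diff_right xx yy inner_commute[of y x]
        inner_complex_def power2_eq_square algebra_simps flip: c_def)
    then show "norm (1 - Complex c s) = norm (x - y)" by simp
  qed
qed

text \<open>
  The point \<open>b\<close> of the unit circle that represents \<open>y\<close> on the great circle from \<open>x\<close> (at \<open>b = 1\<close>)
  satisfies \<open>|1 - b| = |x - y|\<close>, so the planar estimate carries over. The constant \<open>7\<close> is
  \<open>2 \<cdot> 3\<close> for the polynomial of degree \<open>2L\<close> plus \<open>1\<close> for removing the factor \<open>b\<^sup>L\<close>. With \<open>L + 1\<close> in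
  place of \<open>L\<close> the bound also covers antipodal points, where it is trivial.
\<close>

lemma sph_poly_lipschitz:
  fixes f :: "real ^ 'n \<Rightarrow> real"
  assumes f: "f \<in> sph_poly L" and B: "\<And>x. norm x = 1 \<Longrightarrow> \<bar>f x\<bar> \<le> B"
    and x: "norm x = 1" and y: "norm y = 1"
  shows "\<bar>f x - f y\<bar> \<le> 7 * (real L + 1) * B * norm (x - y)"
proof -
  have B0: "B \<ge> 0" using B[OF x] by simp
  have seven: "7 * real L * B * norm (x - y) \<le> 7 * (real L + 1) * B * norm (x - y)"
    using B0 by (intro mult_right_mono) auto
  consider "x = y" | "x = - y" | "x \<noteq> y" "x \<noteq> - y" by blast
  then show ?thesis
  proof cases
    case 1
    then show ?thesis by simp
  next
    case 2
    have "norm (x - y) = norm (2 *\<^sub>R y)" using 2 by (simp add: scaleR_2 norm_minus_commute)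
    then have n: "norm (x - y) = 2" using y by simp
    have "\<bar>f x - f y\<bar> \<le> 2 * B" using B[OF x] B[OF y] by linarith
    also have "\<dots> \<le> 7 * (real L + 1) * B * norm (x - y)"
      using B0 unfolding n by (simp add: algebra_simps)
    finally show ?thesis .
  next
    case 3
    from great_circle_through[OF x y this] obtain v b where
      S: "\<And>b. norm b = 1 \<Longrightarrow> Re b *\<^sub>R x + Im b *\<^sub>R v \<in> sphere 0 1"
      and b: "norm b = 1" "y = Re b *\<^sub>R x + Im b *\<^sub>R v" "norm (1 - b) = norm (x - y)"
      by blast
    from sph_poly_on_great_circle[OF f S] obtain p where p: "degree p \<le> 2 * L"
      "\<And>b. norm b = 1 \<Longrightarrow> poly p b = b ^ L * of_real (f (Re b *\<^sub>R x + Im b *\<^sub>R v))"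
      by blast
    have pB: "norm (poly p z) \<le> B" if "norm z = 1" for z
      using that B S[OF that] by (simp add: p(2) norm_mult norm_power)
    have p1: "poly p 1 = of_real (f x)" and pb: "poly p b = b ^ L * of_real (f y)"
      using p(2)[of 1] p(2)[OF b(1)] b(2) by auto
    have "\<bar>f x - f y\<bar> = norm (poly p 1 - poly p b + (b ^ L - 1) * of_real (f y))"
      by (simp add: p1 pb algebra_simps flip: of_real_diff)
    also have "\<dots> \<le> norm (poly p 1 - poly p b) + norm ((b ^ L - 1) * of_real (f y))"
      by (rule norm_triangle_ineq)
    also have "norm (poly p 1 - poly p b) \<le> 3 * real (2 * L) * B * norm (1 - b)"
      by (rule poly_lipschitz_on_unit_disc[OF pB p(1)]) (use b in auto)
    also have "norm ((b ^ L - 1) * of_real (f y)) \<le> (real L * norm (1 - b)) * B"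
    proof -
      have "norm (b ^ L - 1 ^ L) \<le> real L * norm (b - 1)"
        by (rule norm_power_diff) (use b in auto)
      then show ?thesis
        using B[OF y] unfolding norm_mult
        by (intro mult_mono) (auto simp: norm_minus_commute)
    qed
    finally have "\<bar>f x - f y\<bar> \<le> 7 * real L * B * norm (x - y)"
      by (simp add: b(3) algebra_simps)
    with seven show ?thesis by simp
  qed
qed

section \<open>Surface measure of spherical caps\<close>

lemma space_surface_measure: "space surface_measure = sphere 0 1"
  by (simp add: surface_measure_def space_restrict_space)

lemma sets_surface_measure: "sets surface_measure = sets (restrict_space borel (sphere 0 1))"
  by (simp add: surface_measure_def)

lemma borel_measurable_surface_measure:
  "f \<in> borel_measurable borel \<Longrightarrow> f \<in> borel_measurable surface_measure"
  unfolding measurable_cong_sets[OF sets_surface_measure refl] by (rule measurable_restrict_space1)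

lemma finite_measure_surface_measure:
  "finite_measure (surface_measure :: (real ^ 'n) measure)"
proof
  let ?C = "{r *\<^sub>R x | r (x :: real ^ 'n). 0 < r \<and> r < 1 \<and> x \<in> sphere 0 1}"
  have "emeasure lborel ?C \<le> emeasure lborel (ball (0 :: real ^ 'n) 1)"
    by (rule emeasure_mono) auto
  also have "\<dots> < \<infinity>" by (rule emeasure_lborel_ball_finite)
  finally have "emeasure lborel ?C < \<infinity>" .
  then show "emeasure surface_measure (space (surface_measure :: (real ^ 'n) measure)) \<noteq> \<infinity>"
    by (subst space_surface_measure, subst emeasure_surface_measure)
       (auto simp: ennreal_mult_eq_top_iff)
qed

interpretation surface_measure: finite_measure "surface_measure :: (real ^ 'n) measure"
  by (rule finite_measure_surface_measure)

lemma integrable_surface_measure_bounded: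
  fixes f :: "real ^ 'n \<Rightarrow> real"
  assumes "f \<in> borel_measurable borel" and "\<And>x. norm x = 1 \<Longrightarrow> \<bar>f x\<bar> \<le> B"
  shows "integrable surface_measure f"
  using assms
  by (intro surface_measure.integrable_const_bound[of _ B] borel_measurable_surface_measure AE_I2)
     (auto simp: space_surface_measure)

definition cap :: "real ^ 'n \<Rightarrow> real \<Rightarrow> (real ^ 'n) set" where
  "cap w r = sphere 0 1 \<inter> ball w r"

lemma cap_borel: "cap w r \<in> sets borel"
  by (simp add: cap_def borel_open borel_closed sets.Int)

definition cone :: "(real ^ 'n) set \<Rightarrow> (real ^ 'n) set" where
  "cone A = {r *\<^sub>R x | r x. 0 < r \<and> r < 1 \<and> x \<in> A}"

lemma emeasure_cap:
  fixes w :: "real ^ 'n"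
  shows "emeasure surface_measure (cap w r) = of_nat CARD('n) * emeasure lborel (cone (cap w r))"
  unfolding cone_def by (rule emeasure_surface_measure[OF cap_borel]) (simp add: cap_def)

lemma cone_cap_iff:
  "y \<in> cone (cap w r) \<longleftrightarrow> 0 < norm y \<and> norm y < 1 \<and> norm (y /\<^sub>R norm y - w) < r"
proof
  assume "y \<in> cone (cap w r)"
  then show "0 < norm y \<and> norm y < 1 \<and> norm (y /\<^sub>R norm y - w) < r"
    by (auto simp: cone_def cap_def dist_norm norm_minus_commute)
next
  assume y: "0 < norm y \<and> norm y < 1 \<and> norm (y /\<^sub>R norm y - w) < r"
  then have "y = norm y *\<^sub>R (y /\<^sub>R norm y)" "y /\<^sub>R norm y \<in> cap w r"
    by (auto simp: cap_def dist_norm norm_minus_commute)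
  with y show "y \<in> cone (cap w r)" unfolding cone_def by blast
qed

lemma cone_cap_sets: "cone (cap w r) \<in> sets borel"
proof -
  have "cone (cap w r) = {y \<in> space borel. 0 < norm y \<and> norm y < 1 \<and> norm (y /\<^sub>R norm y - w) < r}"
    using cone_cap_iff by auto
  also have "\<dots> \<in> sets borel" by measurable
  finally show ?thesis .
qed

text \<open>
  The cone over a cap of radius \<open>r\<close> has length \<open>1\<close> and width about \<open>r\<close>: it contains about \<open>1/r\<close>
  disjoint balls of radius \<open>r/8\<close> strung along its axis. They are centred on the part of the
  axis at distance \<open>1/2\<close> to \<open>3/4\<close> from the origin, where the cone is wide enough for them.
\<close>

lemma surface_measure_cap_lower:
  "\<exists>c>0. \<forall>(w :: real ^ 'n) r. norm w = 1 \<longrightarrow> 0 < r \<longrightarrow> r \<le> 1 \<longrightarrow>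
    c * r ^ (CARD('n) - 1) \<le> measure surface_measure (cap w r)"
proof (intro exI conjI allI impI)
  define V where "V = unit_ball_vol (real CARD('n))"
  have V: "V > 0" by (simp add: V_def)
  define c where "c = real CARD('n) * V / 8 ^ CARD('n)"
  show "c > 0" using V by (simp add: c_def)
  fix w :: "real ^ 'n" and r :: real
  assume w: "norm w = 1" and r: "0 < r" "r \<le> 1"
  define m where "m = nat \<lceil>1 / r\<rceil>"
  define B where "B j = ball ((1 / 2 + real j * (r / 4)) *\<^sub>R w) (r / 8)" for j :: nat
  have m: "real m \<ge> 1 / r" unfolding m_def by (rule real_nat_ceiling_ge)
  have jr: "real j * r \<le> 1" if "j < m" for j
  proof -
    have "real j < 1 / r" using that unfolding m_def by linarith
    then show ?thesis using r by (simp add: field_simps)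
  qed
  have sub: "B j \<subseteq> cone (cap w r)" if j: "j < m" for j
  proof
    fix y assume "y \<in> B j"
    define t where "t = 1 / 2 + real j * (r / 4)"
    have t: "1 / 2 \<le> t" "t \<le> 3 / 4" using jr[OF j] r by (auto simp: t_def)
    have y: "norm (y - t *\<^sub>R w) < r / 8"
      using \<open>y \<in> B j\<close> by (simp add: B_def t_def dist_norm norm_minus_commute)
    have tw: "norm (t *\<^sub>R w) = t" using t w by simp
    have ny: "\<bar>norm y - t\<bar> < r / 8"
      using norm_triangle_ineq3[of y "t *\<^sub>R w"] y tw by simp
    have pos: "0 < norm y" and lt: "norm y < 1" using ny t r by linarith+
    have "t *\<^sub>R (y /\<^sub>R norm y - w) = (y - t *\<^sub>R w) + ((t - norm y) / norm y) *\<^sub>R y"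
      using pos by (simp add: algebra_simps diff_divide_distrib divide_inverse)
    then have "norm (t *\<^sub>R (y /\<^sub>R norm y - w)) \<le> norm (y - t *\<^sub>R w) + norm (((t - norm y) / norm y) *\<^sub>R y)"
      by (metis norm_triangle_ineq)
    also have "norm (((t - norm y) / norm y) *\<^sub>R y) = \<bar>norm y - t\<bar>"
      using pos by (simp add: abs_minus_commute)
    finally have "t * norm (y /\<^sub>R norm y - w) < r / 4" using y ny t by simp
    moreover have "1 / 2 * norm (y /\<^sub>R norm y - w) \<le> t * norm (y /\<^sub>R norm y - w)"
      using t by (intro mult_right_mono) auto
    ultimately have "norm (y /\<^sub>R norm y - w) < r" using r by linarith
    with pos lt show "y \<in> cone (cap w r)" by (simp add: cone_cap_iff)
  qed
  have disj: "disjoint_family_on B {..<m}"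
    unfolding disjoint_family_on_def
  proof (intro ballI impI)
    fix i j assume ij: "i \<in> {..<m}" "j \<in> {..<m}" "i \<noteq> j"
    have eq: "(1 / 2 + real i * (r / 4)) - (1 / 2 + real j * (r / 4)) = (real i - real j) * (r / 4)"
      by (simp add: left_diff_distrib)
    have "dist ((1 / 2 + real i * (r / 4)) *\<^sub>R w) ((1 / 2 + real j * (r / 4)) *\<^sub>R w)
        = \<bar>real i - real j\<bar> * (r / 4)"
      unfolding dist_norm scaleR_left_diff_distrib[symmetric] norm_scaleR w eq
      using r by (simp add: abs_mult)
    also have "\<dots> \<ge> 1 * (r / 4)"
      using ij r by (intro mult_right_mono) linarith+
    finally show "B i \<inter> B j = {}"
      unfolding B_def by (intro disjoint_ballI) simp
  qed
  have "ennreal (real m * (V * (r / 8) ^ CARD('n))) = (\<Sum>j<m. emeasure lborel (B j))"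
    using r V by (simp add: B_def emeasure_ball V_def ennreal_mult ennreal_of_nat_eq_real_of_nat)
  also have "\<dots> = emeasure lborel (\<Union>j<m. B j)"
    by (rule sum_emeasure[OF _ disj]) (auto simp: B_def)
  also have "\<dots> \<le> emeasure lborel (cone (cap w r))"
    using sub cone_cap_sets by (intro emeasure_mono) auto
  finally have "of_nat CARD('n) * ennreal (real m * (V * (r / 8) ^ CARD('n)))
      \<le> emeasure surface_measure (cap w r)"
    unfolding emeasure_cap by (rule mult_left_mono) simp
  then have "real CARD('n) * (real m * (V * (r / 8) ^ CARD('n))) \<le> measure surface_measure (cap w r)"
    using V r by (simp add: surface_measure.emeasure_eq_measure ennreal_of_nat_eq_real_of_nat
        flip: ennreal_mult)
  moreover have "c * r ^ (CARD('n) - 1) \<le> real CARD('n) * (real m * (V * (r / 8) ^ CARD('n)))"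
  proof -
    have "r ^ CARD('n) = r * r ^ (CARD('n) - 1)"
      by (simp flip: power_Suc)
    then have "c * r ^ (CARD('n) - 1) = real CARD('n) * (1 / r * (V * (r / 8) ^ CARD('n)))"
      using r by (simp add: c_def power_divide)
    also have "\<dots> \<le> real CARD('n) * (real m * (V * (r / 8) ^ CARD('n)))"
      using m V r by (intro mult_left_mono mult_right_mono) auto
    finally show ?thesis .
  qed
  ultimately show "c * r ^ (CARD('n) - 1) \<le> measure surface_measure (cap w r)" by simp
qed

text \<open>
  Conversely the cone over a cap of radius \<open>r \<le> 2\<close> is covered by at most \<open>1/r + 1 \<le> 3/r\<close> balls of
  radius \<open>2r\<close> centred on its axis. For \<open>r > 2\<close> the bound follows from the volume of the unit ball.
\<close>

lemma surface_measure_cap_upper: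
  "\<exists>C>0. \<forall>(w :: real ^ 'n) r. norm w = 1 \<longrightarrow> 0 < r \<longrightarrow>
    measure surface_measure (cap w r) \<le> C * r ^ (CARD('n) - 1)"
proof (intro exI conjI allI impI)
  define V where "V = unit_ball_vol (real CARD('n))"
  have V: "V > 0" by (simp add: V_def)
  define C where "C = real CARD('n) * (3 * V * 2 ^ CARD('n))"
  show "C > 0" using V by (simp add: C_def)
  fix w :: "real ^ 'n" and r :: real
  assume w: "norm w = 1" and r: "0 < r"
  have pr: "r ^ CARD('n) = r * r ^ (CARD('n) - 1)"
    by (simp flip: power_Suc)
  have "emeasure lborel (cone (cap w r)) \<le> ennreal (3 * V * 2 ^ CARD('n) * r ^ (CARD('n) - 1))"
  proof (cases "r \<le> 2")
    case True
    define m where "m = nat \<lfloor>1 / r\<rfloor>"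
    define B where "B j = ball ((real j * r) *\<^sub>R w) (2 * r)" for j :: nat
    have m: "real m \<le> 1 / r" using r by (simp add: m_def)
    have "cone (cap w r) \<subseteq> (\<Union>j\<le>m. B j)"
    proof
      fix y assume "y \<in> cone (cap w r)"
      then obtain s x where y: "y = s *\<^sub>R x" "0 < s" "s < 1" "norm x = 1" "norm (x - w) < r"
        by (auto simp: cone_def cap_def dist_norm norm_minus_commute)
      define j where "j = nat \<lfloor>s / r\<rfloor>"
      have j: "real j \<le> s / r" "s / r < real j + 1" using r y by (simp_all add: j_def)
      then have js: "real j * r \<le> s" "s < real j * r + r" using r by (simp_all add: field_simps)
      have "s / r \<le> 1 / r" using y r by (simp add: divide_right_mono)
      then have jm: "j \<le> m" unfolding j_def m_def by (intro nat_mono floor_mono)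
      have "y - (real j * r) *\<^sub>R w = s *\<^sub>R (x - w) + (s - real j * r) *\<^sub>R w"
        by (simp add: y algebra_simps)
      then have "norm (y - (real j * r) *\<^sub>R w) \<le> norm (s *\<^sub>R (x - w)) + norm ((s - real j * r) *\<^sub>R w)"
        by (metis norm_triangle_ineq)
      also have "\<dots> = s * norm (x - w) + (s - real j * r)" using y js w by simp
      also have "s * norm (x - w) \<le> 1 * norm (x - w)" using y by (intro mult_right_mono) auto
      finally have "norm (y - (real j * r) *\<^sub>R w) < 2 * r" using y js by simp
      with jm show "y \<in> (\<Union>j\<le>m. B j)"
        by (auto simp: B_def dist_norm norm_minus_commute)
    qed
    then have "emeasure lborel (cone (cap w r)) \<le> emeasure lborel (\<Union>j\<le>m. B j)"
      by (rule emeasure_mono) (auto simp: B_def)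
    also have "\<dots> \<le> (\<Sum>j\<le>m. emeasure lborel (B j))"
      by (rule emeasure_subadditive_finite) (auto simp: B_def)
    also have "\<dots> = (\<Sum>j\<le>m. ennreal (V * (2 * r) ^ CARD('n)))"
      using r by (simp add: B_def emeasure_ball V_def)
    also have "\<dots> = ennreal ((real m + 1) * (V * (2 * r) ^ CARD('n)))"
      using r V by (subst sum_ennreal) auto
    also have "\<dots> \<le> ennreal (3 / r * (V * (2 * r) ^ CARD('n)))"
    proof -
      have "1 \<le> 2 / r" using True r by simp
      then have "real m + 1 \<le> 3 / r" using m by (simp add: add_divide_distrib[symmetric] field_simps)
      then show ?thesis using V r by (intro ennreal_leI mult_right_mono) auto
    qed
    also have "3 / r * (V * (2 * r) ^ CARD('n)) = 3 * V * 2 ^ CARD('n) * r ^ (CARD('n) - 1)"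
      using r by (simp add: pr power_mult_distrib)
    finally show ?thesis .
  next
    case False
    have "emeasure lborel (cone (cap w r)) \<le> emeasure lborel (ball (0 :: real ^ 'n) 1)"
      by (rule emeasure_mono) (auto simp: cone_cap_iff)
    also have "\<dots> = ennreal (V * (1 * 1))" by (simp add: emeasure_ball V_def)
    also have "\<dots> \<le> ennreal (3 * V * (2 ^ CARD('n) * r ^ (CARD('n) - 1)))"
      using V False by (intro ennreal_leI mult_mono) (auto intro: mult_ge1_I one_le_power)
    finally show ?thesis by (simp add: mult_ac)
  qed
  then have "emeasure surface_measure (cap w r)
      \<le> of_nat CARD('n) * ennreal (3 * V * 2 ^ CARD('n) * r ^ (CARD('n) - 1))"
    unfolding emeasure_cap by (rule mult_left_mono) simp
  also have "\<dots> = ennreal (C * r ^ (CARD('n) - 1))"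
    using V r by (simp add: C_def ennreal_of_nat_eq_real_of_nat mult_ac flip: ennreal_mult)
  finally show "measure surface_measure (cap w r) \<le> C * r ^ (CARD('n) - 1)"
    using V r by (simp add: surface_measure.emeasure_eq_measure C_def)
qed

section \<open>Decaying weights on the sphere\<close>

text \<open>
  The exponent exceeds \<open>dim S\<^sup>d = CARD('n) - 1\<close> by two, so that the sum over the annuli of
  width \<open>1/n\<close> is comparable with \<open>\<Sum>1/k\<^sup>2\<close>.
\<close>

definition decay :: "real \<Rightarrow> real ^ 'n \<Rightarrow> real ^ 'n \<Rightarrow> real" where
  "decay n w x = 1 / (1 + n * norm (x - w)) ^ (CARD('n) + 1)"

lemma decay_pos: "n \<ge> 0 \<Longrightarrow> decay n w x > 0"
  by (simp add: decay_def add_pos_nonneg)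

lemma decay_le_1: "n \<ge> 0 \<Longrightarrow> decay n w x \<le> 1"
  unfolding decay_def by (subst divide_le_eq_1_pos) (auto intro: one_le_power simp del: power_Suc add_Suc_right simp: add_pos_nonneg)

lemma decay_commute: "decay n w x = decay n x w"
  by (simp add: decay_def norm_minus_commute)

lemma decay_borel: "decay n w \<in> borel_measurable borel"
  unfolding decay_def[abs_def] by measurable

lemma integrable_decay: "n \<ge> 0 \<Longrightarrow> integrable surface_measure (decay n w)"
  by (rule integrable_surface_measure_bounded[of _ 1])
     (auto simp: decay_borel abs_of_pos decay_pos decay_le_1)

lemma integrable_cap: "integrable surface_measure (\<lambda>x. indicator (cap w r) x :: real)"
  by (rule integrable_surface_measure_bounded[of _ 1]) (auto simp: cap_borel indicator_def intro!: borel_measurable_indicator[OF cap_borel, unfolded indicator_def])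

lemma cap_Int_space [simp]: "cap w r \<inter> space surface_measure = cap w r"
  by (auto simp: cap_def space_surface_measure)

text \<open>
  On the annulus \<open>k/n \<le> norm (x - w) < (k + 1)/n\<close> the weight is at most \<open>(k + 1)\<^sup>-\<^sup>(\<^sup>d\<^sup>+\<^sup>2\<^sup>)\<close>, while
  the cap enclosing it has measure of order \<open>((k + 1)/n)\<^sup>d\<close>.
\<close>

lemma integral_decay_le:
  "\<exists>C>0. \<forall>(w :: real ^ 'n) n. norm w = 1 \<longrightarrow> n \<ge> 1 \<longrightarrow>
    (\<integral>x. decay n w x \<partial>surface_measure) \<le> C / n ^ (CARD('n) - 1)"
proof -
  obtain C where C: "C > 0" and cap: "\<And>(w :: real ^ 'n) r. norm w = 1 \<Longrightarrow> 0 < r \<Longrightarrow>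
      measure surface_measure (cap w r) \<le> C * r ^ (CARD('n) - 1)"
    using surface_measure_cap_upper by blast
  define Z where "Z = (\<Sum>k. 1 / (real (Suc k))\<^sup>2)"
  have summ: "summable (\<lambda>k. 1 / (real (Suc k))\<^sup>2)"
    using inverse_power_summable[of 2, where 'a = real]
    by (subst summable_Suc_iff[of "\<lambda>k. 1 / (real k)\<^sup>2"]) (simp add: inverse_eq_divide)
  have "(\<Sum>k<1. 1 / (real (Suc k))\<^sup>2) \<le> Z"
    unfolding Z_def by (rule sum_le_suminf[OF summ]) auto
  then have Z: "Z > 0" by simp
  have "(\<integral>x. decay n w x \<partial>surface_measure) \<le> (C * Z) / n ^ (CARD('n) - 1)"
    if w: "norm w = 1" and n: "n \<ge> 1" for w :: "real ^ 'n" and n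
  proof -
    \<comment> \<open>The sphere has diameter \<open>2\<close>, so the annuli with index below \<open>K\<close> exhaust it.\<close>
    define K where "K = nat \<lfloor>2 * n\<rfloor> + 1"
    define a where "a k = 1 / real (Suc k) ^ (CARD('n) + 1)" for k
    define A where "A k = cap w (real (Suc k) / n)" for k
    have pt: "decay n w x \<le> (\<Sum>k<K. a k * indicator (A k) x)"
      if x: "x \<in> space surface_measure" for x
    proof -
      have nx: "norm x = 1" using x by (simp add: space_surface_measure)
      define k where "k = nat \<lfloor>n * norm (x - w)\<rfloor>"
      have k: "real k \<le> n * norm (x - w)" "n * norm (x - w) < real k + 1"
        using n by (simp_all add: k_def)
      have "norm (x - w) \<le> 2" using norm_triangle_ineq4[of x w] nx w by simp
      then have "n * norm (x - w) \<le> 2 * n" using n by simp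
      then have kK: "k < K" unfolding k_def K_def by (simp add: nat_mono floor_mono less_Suc_eq_le)
      have "x \<in> A k"
        using k n nx by (simp add: A_def cap_def dist_norm norm_minus_commute field_simps)
      have "decay n w x \<le> a k"
        unfolding decay_def a_def using k by (intro divide_left_mono power_mono) (auto intro!: add_pos_nonneg mult_pos_pos zero_less_power)
      also have "\<dots> = a k * indicator (A k) x" using \<open>x \<in> A k\<close> by simp
      also have "\<dots> \<le> (\<Sum>k<K. a k * indicator (A k) x)"
        using kK by (intro member_le_sum) (auto simp: a_def)
      finally show ?thesis .
    qed
    have "(\<integral>x. decay n w x \<partial>surface_measure) \<le> (\<integral>x. (\<Sum>k<K. a k * indicator (A k) x) \<partial>surface_measure)"
      using n by (intro integral_mono pt integrable_decay Bochner_Integration.integrable_sum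
          integrable_mult_right integrable_cap[of w, folded A_def]) (auto simp: A_def integrable_cap)
    also have "\<dots> = (\<Sum>k<K. a k * measure surface_measure (A k))"
      by (subst Bochner_Integration.integral_sum) (auto simp: A_def integrable_cap)
    also have "\<dots> \<le> (\<Sum>k<K. (C / n ^ (CARD('n) - 1)) * (1 / (real (Suc k))\<^sup>2))"
    proof (rule sum_mono)
      fix k
      have "a k * measure surface_measure (A k) \<le> a k * (C * (real (Suc k) / n) ^ (CARD('n) - 1))"
        unfolding A_def using n by (intro mult_left_mono cap w) (auto simp: a_def)
      also have "real (Suc k) ^ (CARD('n) + 1) = real (Suc k) ^ (CARD('n) - 1) * (real (Suc k))\<^sup>2"
        by (simp flip: power_add)
      then have "a k * (C * (real (Suc k) / n) ^ (CARD('n) - 1)) = (C / n ^ (CARD('n) - 1)) * (1 / (real (Suc k))\<^sup>2)"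
        by (simp add: a_def power_divide)
      finally show "a k * measure surface_measure (A k) \<le> (C / n ^ (CARD('n) - 1)) * (1 / (real (Suc k))\<^sup>2)" .
    qed
    also have "\<dots> = (C / n ^ (CARD('n) - 1)) * (\<Sum>k<K. 1 / (real (Suc k))\<^sup>2)"
      by (simp only: sum_distrib_left)
    also have "\<dots> \<le> (C / n ^ (CARD('n) - 1)) * Z"
      unfolding Z_def using C n by (intro mult_left_mono sum_le_suminf[OF summ]) auto
    finally show ?thesis by simp
  qed
  with C Z show ?thesis by (intro exI[of _ "C * Z"]) auto
qed

text \<open>
  Around separated points there are disjoint caps on each of which the weight is almost constant,
  so the sum over the points is dominated by the integral.
\<close>

lemma sum_decay_separated_le:
  "\<exists>C>0. \<forall>(w :: real ^ 'n) n \<delta> (z :: nat \<Rightarrow> real ^ 'n) J.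
    norm w = 1 \<longrightarrow> n \<ge> 1 \<longrightarrow> 0 < \<delta> \<longrightarrow> n * \<delta> \<le> 1 \<longrightarrow> finite J \<longrightarrow>
    (\<forall>j\<in>J. norm (z j) = 1) \<longrightarrow> (\<forall>i\<in>J. \<forall>j\<in>J. i \<noteq> j \<longrightarrow> \<delta> \<le> norm (z i - z j)) \<longrightarrow>
    (\<Sum>j\<in>J. decay n w (z j)) \<le> C / (n * \<delta>) ^ (CARD('n) - 1)"
proof -
  obtain c where c: "c > 0" and cap: "\<And>(w :: real ^ 'n) r. norm w = 1 \<Longrightarrow> 0 < r \<Longrightarrow> r \<le> 1 \<Longrightarrow>
      c * r ^ (CARD('n) - 1) \<le> measure surface_measure (cap w r)"
    using surface_measure_cap_lower by blast
  obtain C where C: "C > 0" and int: "\<And>(w :: real ^ 'n) n. norm w = 1 \<Longrightarrow> n \<ge> 1 \<Longrightarrow>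
      (\<integral>x. decay n w x \<partial>surface_measure) \<le> C / n ^ (CARD('n) - 1)"
    using integral_decay_le by blast
  define D where "D = 2 ^ (CARD('n) + 1) * C * 2 ^ (CARD('n) - 1) / c"
  have main: "(\<Sum>j\<in>J. decay n w (z j)) \<le> D / (n * \<delta>) ^ (CARD('n) - 1)"
    if w: "norm w = 1" and n: "n \<ge> 1" and \<delta>: "0 < \<delta>" "n * \<delta> \<le> 1" and J: "finite J"
      and z: "\<And>j. j \<in> J \<Longrightarrow> norm (z j) = 1"
      and sep: "\<And>i j. i \<in> J \<Longrightarrow> j \<in> J \<Longrightarrow> i \<noteq> j \<Longrightarrow> \<delta> \<le> norm (z i - z j)"
    for w :: "real ^ 'n" and n \<delta> and z :: "nat \<Rightarrow> real ^ 'n" and J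
  proof -
    have "1 * \<delta> \<le> n * \<delta>" using n \<delta> by (intro mult_right_mono) auto
    then have \<delta>1: "\<delta> \<le> 1" using \<delta> by linarith
    have disj: "cap (z i) (\<delta> / 2) \<inter> cap (z j) (\<delta> / 2) = {}" if "i \<in> J" "j \<in> J" "i \<noteq> j" for i j
    proof -
      have "ball (z i) (\<delta> / 2) \<inter> ball (z j) (\<delta> / 2) = {}"
        by (rule disjoint_ballI) (use sep[OF that] in \<open>simp add: dist_norm\<close>)
      then show ?thesis by (auto simp: cap_def)
    qed
    \<comment> \<open>Within distance \<open>\<delta>/2\<close> of \<open>z j\<close> the base \<open>1 + n norm (x - w)\<close> varies at most by a factor \<open>2\<close>.\<close>
    have pt: "(\<Sum>j\<in>J. decay n w (z j) * indicator (cap (z j) (\<delta> / 2)) x) \<le> 2 ^ (CARD('n) + 1) * decay n w x"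
      for x
    proof (cases "\<exists>j\<in>J. x \<in> cap (z j) (\<delta> / 2)")
      case True
      then obtain j where j: "j \<in> J" "x \<in> cap (z j) (\<delta> / 2)" by blast
      have "x \<notin> cap (z i) (\<delta> / 2)" if "i \<in> J - {j}" for i using disj[of i j] that j by auto
      then have "(\<Sum>i\<in>J. decay n w (z i) * indicator (cap (z i) (\<delta> / 2)) x) = decay n w (z j)"
        using j J by (subst sum.remove[of J j]) (auto intro!: sum.neutral)
      also have "\<dots> \<le> 2 ^ (CARD('n) + 1) * decay n w x"
      proof -
        have "norm (x - w) \<le> norm (z j - w) + norm (x - z j)"
          using norm_triangle_ineq[of "x - z j" "z j - w"] by simp
        also have "norm (x - z j) \<le> \<delta> / 2" using j by (simp add: cap_def dist_norm norm_minus_commute)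
        finally have "n * norm (x - w) \<le> n * (norm (z j - w) + \<delta> / 2)" using n by simp
        also have "\<dots> \<le> n * norm (z j - w) + 1" using \<delta> by (simp add: algebra_simps)
        finally have "n * norm (x - w) \<le> n * norm (z j - w) + 1" .
        moreover have "0 \<le> n * norm (z j - w)" using n by simp
        ultimately have "1 + n * norm (x - w) \<le> 2 * (1 + n * norm (z j - w))"
          by simp
        then have "(1 + n * norm (x - w)) ^ (CARD('n) + 1) \<le> (2 * (1 + n * norm (z j - w))) ^ (CARD('n) + 1)"
          using n by (intro power_mono) auto
        moreover have "1 + n * norm (x - w) > 0" "1 + n * norm (z j - w) > 0"
          using n by (auto intro!: add_pos_nonneg)
        ultimately show ?thesis
          unfolding decay_def power_mult_distrib by (simp add: field_simps del: power_Suc power_add add_Suc_right)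
      qed
      finally show ?thesis .
    next
      case False
      then have "(\<Sum>j\<in>J. decay n w (z j) * indicator (cap (z j) (\<delta> / 2)) x) = 0"
        by (intro sum.neutral) auto
      then show ?thesis using decay_pos[of n w x] n by simp
    qed
    have "(\<Sum>j\<in>J. decay n w (z j)) * (c * (\<delta> / 2) ^ (CARD('n) - 1))
        \<le> (\<Sum>j\<in>J. decay n w (z j) * measure surface_measure (cap (z j) (\<delta> / 2)))"
      unfolding sum_distrib_right using z \<delta> \<delta>1 n
      by (intro sum_mono mult_left_mono cap less_imp_le[OF decay_pos]) auto
    also have "\<dots> = (\<integral>x. (\<Sum>j\<in>J. decay n w (z j) * indicator (cap (z j) (\<delta> / 2)) x) \<partial>surface_measure)"
      by (subst Bochner_Integration.integral_sum) (auto simp: integrable_cap)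
    also have "\<dots> \<le> (\<integral>x. 2 ^ (CARD('n) + 1) * decay n w x \<partial>surface_measure)"
      using n by (intro integral_mono pt integrable_mult_right Bochner_Integration.integrable_sum
          integrable_cap integrable_decay) auto
    also have "\<dots> \<le> 2 ^ (CARD('n) + 1) * (C / n ^ (CARD('n) - 1))"
      using mult_left_mono[OF int[OF w n], of "2 ^ (CARD('n) + 1)"] by simp
    finally have "(\<Sum>j\<in>J. decay n w (z j)) \<le> 2 ^ (CARD('n) + 1) * (C / n ^ (CARD('n) - 1)) / (c * (\<delta> / 2) ^ (CARD('n) - 1))"
      using c \<delta> by (subst pos_le_divide_eq) auto
    also have "\<dots> = D / (n * \<delta>) ^ (CARD('n) - 1)"
      by (simp add: D_def power_divide power_mult_distrib)
    finally show ?thesis .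
  qed
  have "D > 0" using c C by (simp add: D_def)
  then show ?thesis
    by (intro exI[of _ D] conjI allI impI main) blast+
qed

section \<open>A weighted Jensen inequality\<close>

lemma powr_above_tangent:
  fixes p s t :: real
  assumes "p \<ge> 1" "s > 0" "t \<ge> 0"
  shows "s powr p + p * s powr (p - 1) * (t - s) \<le> t powr p"
proof (cases "t = 0")
  case True
  have "s powr p = s * s powr (p - 1)" using assms by (simp add: powr_mult_base)
  then have "s powr p + p * s powr (p - 1) * (t - s) = (1 - p) * (s * s powr (p - 1))"
    by (simp add: True algebra_simps)
  also have "\<dots> \<le> 0" using assms by (intro mult_nonpos_nonneg) auto
  finally show ?thesis by (simp add: True)
next
  case False
  have "t powr p - s powr p \<ge> p * s powr (p - 1) * (t - s)"
  proof (rule convex_on_imp_above_tangent[where A = "{0<..}"])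
    show "convex_on {0<..} (\<lambda>x. x powr p)"
      using powr_convex[OF assms(1)] by (rule convex_on_subset) (auto simp: convex_real_interval)
    show "((\<lambda>x. x powr p) has_field_derivative p * s powr (p - 1)) (at s within {0<..})"
      using assms by (auto intro!: derivative_eq_intros)
  qed (use assms False in \<open>auto simp: interior_open\<close>)
  then show ?thesis by simp
qed

text \<open>
  Integrate the tangent line of \<open>t \<mapsto> t\<^sup>p\<close> at the weighted mean \<open>(\<integral>w f) / W\<close>. Allowing \<open>W\<close> to exceed
  the total weight lets an upper bound for it be used directly.
\<close>

lemma weighted_jensen_powr:
  fixes f w :: "'a \<Rightarrow> real"
  assumes p: "p \<ge> 1" and f: "\<And>x. x \<in> space M \<Longrightarrow> f x \<ge> 0" and w: "\<And>x. x \<in> space M \<Longrightarrow> w x \<ge> 0"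
    and int: "integrable M w" "integrable M (\<lambda>x. w x * f x)" "integrable M (\<lambda>x. w x * f x powr p)"
    and W: "(\<integral>x. w x \<partial>M) \<le> W" "W > 0"
  shows "(\<integral>x. w x * f x \<partial>M) powr p \<le> W powr (p - 1) * (\<integral>x. w x * f x powr p \<partial>M)"
proof -
  define A where "A = (\<integral>x. w x * f x \<partial>M)"
  have A0: "A \<ge> 0" unfolding A_def using f w by (intro integral_nonneg_AE AE_I2) auto
  show ?thesis
  proof (cases "A = 0")
    case True
    have "(\<integral>x. w x * f x powr p \<partial>M) \<ge> 0" using w by (intro integral_nonneg_AE AE_I2) auto
    with True show ?thesis by (simp add: A_def)
  next
    case False
    define s where "s = A / W"
    have s: "s > 0" using A0 False W by (simp add: s_def)
    define q where "q = s powr (p - 1)"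
    have q: "s powr p = s * q" using s by (simp add: q_def powr_mult_base)
    have q0: "q > 0" using s by (simp add: q_def)
    have "s * q * (\<integral>x. w x \<partial>M) + p * q * (A - s * (\<integral>x. w x \<partial>M))
        = (\<integral>x. s * q * w x + p * q * (w x * f x - s * w x) \<partial>M)"
      using int by (simp add: A_def)
    also have "\<dots> \<le> (\<integral>x. w x * f x powr p \<partial>M)"
    proof (rule integral_mono)
      fix x assume x: "x \<in> space M"
      have "w x * (s * q + p * q * (f x - s)) \<le> w x * f x powr p"
        using powr_above_tangent[OF p s f[OF x]] w[OF x] unfolding q q_def[symmetric]
        by (intro mult_left_mono) auto
      then show "s * q * w x + p * q * (w x * f x - s * w x) \<le> w x * f x powr p"
        by (simp add: algebra_simps)
    qed (use int in auto)
    finally have le: "p * q * A - (p - 1) * q * s * (\<integral>x. w x \<partial>M) \<le> (\<integral>x. w x * f x powr p \<partial>M)"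
      by (simp add: algebra_simps)
    have "(p - 1) * q * s * (\<integral>x. w x \<partial>M) \<le> (p - 1) * q * s * W"
      using W p q0 s by (intro mult_left_mono) auto
    also have "\<dots> = (p - 1) * q * A" using W by (simp add: s_def)
    finally have "q * A \<le> (\<integral>x. w x * f x powr p \<partial>M)" using le by (simp add: algebra_simps)
    then have "W powr (p - 1) * (q * A) \<le> W powr (p - 1) * (\<integral>x. w x * f x powr p \<partial>M)"
      by (intro mult_left_mono) auto
    moreover have "W powr (p - 1) * (q * A) = A powr p"
      using W A0 False by (simp add: q_def s_def powr_divide powr_mult_base mult.commute)
    ultimately show ?thesis by (simp add: A_def)
  qed
qed

lemma weighted_jensen_powr_sum:
  fixes f w :: "'a \<Rightarrow> real"
  assumes "p \<ge> 1" "finite J" "\<And>j. j \<in> J \<Longrightarrow> f j \<ge> 0" "\<And>j. j \<in> J \<Longrightarrow> w j \<ge> 0"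
    and "(\<Sum>j\<in>J. w j) \<le> W" "W > 0"
  shows "(\<Sum>j\<in>J. w j * f j) powr p \<le> W powr (p - 1) * (\<Sum>j\<in>J. w j * f j powr p)"
  using weighted_jensen_powr[of p "count_space J" f w W] assms
  by (simp add: lebesgue_integral_count_space_finite integrable_count_space)

section \<open>A localised polynomial kernel\<close>

text \<open>
  The Dirichlet kernel \<open>D\<^sub>k(cos \<theta>) = sin((k + 1/2) \<theta>) / sin(\<theta>/2)\<close> as a polynomial in \<open>cos \<theta>\<close>,
  given by its three-term recurrence.
\<close>

fun dirichlet :: "nat \<Rightarrow> real \<Rightarrow> real" where
  "dirichlet 0 t = 1"
| "dirichlet (Suc 0) t = 1 + 2 * t"
| "dirichlet (Suc (Suc k)) t = 2 * t * dirichlet (Suc k) t - dirichlet k t"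

lemma dirichlet_1: "dirichlet k 1 = 2 * real k + 1"
  by (induction k "1 :: real" rule: dirichlet.induct) auto

lemma dirichlet_cos_double: "dirichlet k (cos (2 * \<phi>)) * sin \<phi> = sin ((2 * real k + 1) * \<phi>)"
proof (induction k "cos (2 * \<phi>)" rule: dirichlet.induct)
  case 2
  have "sin (3 * \<phi>) = sin (2 * \<phi> + \<phi>)" by (simp add: algebra_simps)
  also have "\<dots> = 2 * sin \<phi> * (cos \<phi>)\<^sup>2 + cos (2 * \<phi>) * sin \<phi>"
    unfolding sin_add sin_double by (simp add: power2_eq_square)
  also have "2 * (cos \<phi>)\<^sup>2 = 1 + cos (2 * \<phi>)" by (simp add: cos_double_cos)
  then have "2 * sin \<phi> * (cos \<phi>)\<^sup>2 = (1 + cos (2 * \<phi>)) * sin \<phi>" by (simp add: algebra_simps)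
  finally show ?case by (simp add: algebra_simps)
next
  case (3 k)
  define \<psi> where "\<psi> = (2 * real (Suc k) + 1) * \<phi>"
  have "sin ((2 * real (Suc (Suc k)) + 1) * \<phi>) = sin (\<psi> + 2 * \<phi>)"
    and "sin ((2 * real k + 1) * \<phi>) = sin (\<psi> - 2 * \<phi>)"
    by (simp_all add: \<psi>_def algebra_simps)
  then have "sin ((2 * real (Suc (Suc k)) + 1) * \<phi>) = 2 * cos (2 * \<phi>) * sin \<psi> - sin ((2 * real k + 1) * \<phi>)"
    by (simp add: sin_add sin_diff)
  with 3 show ?case by (simp add: \<psi>_def algebra_simps)
qed simp

lemma abs_sin_multiple_le: "\<bar>sin (real m * \<phi>)\<bar> \<le> real m * \<bar>sin \<phi>\<bar>"
proof (induction m)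
  case (Suc m)
  have "\<bar>sin (real (Suc m) * \<phi>)\<bar> = \<bar>sin (real m * \<phi>) * cos \<phi> + cos (real m * \<phi>) * sin \<phi>\<bar>"
    unfolding sin_add[symmetric] by (simp add: distrib_right add.commute)
  also have "\<dots> \<le> \<bar>sin (real m * \<phi>)\<bar> * \<bar>cos \<phi>\<bar> + \<bar>cos (real m * \<phi>)\<bar> * \<bar>sin \<phi>\<bar>"
    using abs_triangle_ineq by (simp flip: abs_mult)
  also have "\<dots> \<le> \<bar>sin (real m * \<phi>)\<bar> * 1 + 1 * \<bar>sin \<phi>\<bar>"
    by (intro add_mono mult_left_mono mult_right_mono) auto
  finally show ?case using Suc by (simp add: algebra_simps)
qed simp

lemma dirichlet_inner_in_sph_poly:
  fixes w :: "real ^ 'n"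
  shows "(\<lambda>x. if x \<in> sphere 0 1 then dirichlet k (inner x w) else 0) \<in> sph_poly k"
proof (induction k rule: less_induct)
  case (less k)
  consider "k = 0" | "k = 1" | j where "k = Suc (Suc j)"
    by (metis One_nat_def not0_implies_Suc)
  then show ?case
  proof cases
    case 1
    then show ?thesis using sph_poly_const[of 1 0] by (simp cong: if_cong)
  next
    case 2
    have "(\<lambda>x. (if x \<in> sphere 0 1 then 1 else 0) + 2 * (if x \<in> sphere 0 1 then inner x w else 0)) \<in> sph_poly 1"
      by (intro sph_poly_add sph_poly_scale sph_poly_const sph_poly_inner)
    then show ?thesis unfolding 2
      by (rule back_subst[where P = "\<lambda>f. f \<in> sph_poly 1"]) auto
  next
    case (3 j)
    let ?D = "\<lambda>i x. if x \<in> sphere 0 1 then dirichlet i (inner x w) else 0"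
    have "(\<lambda>x. (if x \<in> sphere 0 1 then inner x w else 0) * ?D (Suc j) x) \<in> sph_poly (1 + Suc j)"
      using 3 by (intro sph_poly_mult sph_poly_inner less) simp
    moreover have "?D j \<in> sph_poly (1 + Suc j)"
      using less[of j] 3 sph_poly_mono[of j "1 + Suc j"] by auto
    ultimately have lin: "(\<lambda>x. 2 * ((if x \<in> sphere 0 1 then inner x w else 0) * ?D (Suc j) x) + (- 1) * ?D j x)
        \<in> sph_poly (1 + Suc j)"
      by (intro sph_poly_add sph_poly_scale)
    have deg: "1 + Suc j = k" using 3 by simp
    from lin[unfolded deg] show ?thesis
      by (rule back_subst[where P = "\<lambda>f. f \<in> sph_poly k"]) (auto simp: 3)
  qed
qed

text \<open>
  With \<open>inner x w = cos 2\<phi>\<close> one has \<open>norm (x - w) = 2 |sin \<phi>|\<close>, so the normalised Dirichlet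
  kernel is bounded both by \<open>1\<close> and by \<open>2 / ((2k + 1) norm (x - w))\<close>. The minimum of \<open>1\<close> and
  \<open>2/t\<close> is at most \<open>3/(1 + t)\<close>.
\<close>

lemma dirichlet_inner_bound:
  fixes x w :: "real ^ 'n"
  assumes x: "norm x = 1" and w: "norm w = 1"
  shows "\<bar>dirichlet k (inner x w)\<bar> / (2 * real k + 1) \<le> 3 / (1 + (2 * real k + 1) * norm (x - w))"
proof (cases "x = w")
  case True
  then have "inner x w = 1" using w by (simp add: dot_square_norm)
  then show ?thesis by (simp add: dirichlet_1 True)
next
  case False
  have xx: "inner x x = 1" and ww: "inner w w = 1"
    using x w by (simp_all add: dot_square_norm)
  define \<phi> where "\<phi> = arccos (inner x w) / 2"
  define K where "K = 2 * real k + 1"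
  have K: "K > 0" by (simp add: K_def)
  have "\<bar>inner x w\<bar> \<le> 1" using Cauchy_Schwarz_ineq2[of x w] x w by simp
  then have c: "inner x w = cos (2 * \<phi>)" by (simp add: \<phi>_def cos_arccos_abs)
  have "(norm (x - w))\<^sup>2 = 2 - 2 * inner x w"
    unfolding power2_norm_eq_inner
    by (simp add: inner_diff_left inner_diff_right xx ww inner_commute[of w x])
  also have "\<dots> = (2 * \<bar>sin \<phi>\<bar>)\<^sup>2"
    unfolding c cos_double_sin by (simp add: power_mult_distrib)
  finally have n: "norm (x - w) = 2 * \<bar>sin \<phi>\<bar>"
    by (rule power2_eq_imp_eq) auto
  with False have s: "\<bar>sin \<phi>\<bar> > 0" by auto
  have D: "\<bar>dirichlet k (inner x w)\<bar> * \<bar>sin \<phi>\<bar> = \<bar>sin (K * \<phi>)\<bar>"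
    unfolding c abs_mult[symmetric] dirichlet_cos_double K_def ..
  have "\<bar>sin (K * \<phi>)\<bar> \<le> K * \<bar>sin \<phi>\<bar>"
    using abs_sin_multiple_le[of "2 * k + 1" \<phi>] by (simp add: K_def add.commute)
  with D have "\<bar>dirichlet k (inner x w)\<bar> * \<bar>sin \<phi>\<bar> \<le> K * \<bar>sin \<phi>\<bar>" by simp
  then have d1: "\<bar>dirichlet k (inner x w)\<bar> \<le> K" using s by simp
  have d2: "\<bar>dirichlet k (inner x w)\<bar> * norm (x - w) \<le> 2"
    using D n by simp
  have "\<bar>dirichlet k (inner x w)\<bar> * (1 + K * norm (x - w))
      = \<bar>dirichlet k (inner x w)\<bar> + K * (\<bar>dirichlet k (inner x w)\<bar> * norm (x - w))"
    by (simp add: algebra_simps)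
  also have "\<dots> \<le> K + K * 2" using d1 d2 K by (intro add_mono mult_left_mono) auto
  finally have "\<bar>dirichlet k (inner x w)\<bar> * (1 + K * norm (x - w)) \<le> 3 * K" by simp
  moreover have "1 + K * norm (x - w) > 0" using K by (intro add_pos_nonneg) auto
  ultimately have "\<bar>dirichlet k (inner x w)\<bar> \<le> 3 * K / (1 + K * norm (x - w))"
    by (subst pos_le_divide_eq) auto
  then have "\<bar>dirichlet k (inner x w)\<bar> / K \<le> 3 * K / (1 + K * norm (x - w)) / K"
    using K by (intro divide_right_mono) auto
  then show ?thesis using K by (simp add: K_def[symmetric])
qed

text \<open>
  The power \<open>s = CARD('n) + 1\<close> of the normalised Dirichlet kernel of degree \<open>m div s\<close> still has
  degree at most \<open>m\<close>, and its scale parameter \<open>2 (m div s) + 1\<close> is at least \<open>(m + 1) / s\<close>.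
\<close>

lemma localised_kernel:
  "\<exists>C>0. \<forall>m. \<forall>w :: real ^ 'n. norm w = 1 \<longrightarrow> (\<exists>q\<in>sph_poly m. q w = 1 \<and>
    (\<forall>x. norm x = 1 \<longrightarrow> \<bar>q x\<bar> \<le> C * decay (real m + 1) w x))"
proof -
  define s where "s = CARD('n) + 1"
  have s: "s > 0" by (simp add: s_def)
  have "\<exists>q\<in>sph_poly m. q w = 1 \<and>
      (\<forall>x. norm x = 1 \<longrightarrow> \<bar>q x\<bar> \<le> (3 * real s) ^ s * decay (real m + 1) w x)"
    if w: "norm w = 1" for m and w :: "real ^ 'n"
  proof -
    define k where "k = m div s"
    define K where "K = 2 * real k + 1"
    have K: "K > 0" by (simp add: K_def)
    define f where "f = (\<lambda>x. (1 / K) * (if x \<in> sphere 0 1 then dirichlet k (inner x w) else 0))"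
    define q where "q = (\<lambda>x. if x \<in> sphere 0 1 then f x ^ s else 0)"
    have f: "f \<in> sph_poly k"
      unfolding f_def by (intro sph_poly_scale dirichlet_inner_in_sph_poly)
    have "s * k \<le> m" unfolding k_def by simp
    then have "q \<in> sph_poly m"
      using sph_poly_power[OF f, of s] sph_poly_mono[of "s * k" m] unfolding q_def by blast
    moreover have "q w = 1"
      using w K by (simp add: q_def f_def dot_square_norm dirichlet_1 K_def)
    moreover have "\<bar>q x\<bar> \<le> (3 * real s) ^ s * decay (real m + 1) w x" if x: "norm x = 1" for x
    proof -
      have "m < s * k + s" 
        using mult_div_mod_eq[of s m] mod_less_divisor[OF s, of m] unfolding k_def by linarith
      then have "real (m + 1) \<le> real (s * k + s)" unfolding of_nat_le_iff by simp
      also have "\<dots> \<le> real s * K" by (simp add: K_def algebra_simps)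
      finally have mK: "real m + 1 \<le> real s * K" by simp
      have pos: "1 + K * norm (x - w) > 0" "1 + (real m + 1) * norm (x - w) > 0"
        using K by (auto intro!: add_pos_nonneg)
      have "(real m + 1) * norm (x - w) \<le> real s * K * norm (x - w)"
        using mK by (intro mult_right_mono) auto
      moreover have "1 \<le> real s" using s by simp
      ultimately have "1 + (real m + 1) * norm (x - w) \<le> real s * (1 + K * norm (x - w))"
        by (simp add: algebra_simps)
      then have "3 / (1 + K * norm (x - w)) \<le> 3 * real s / (1 + (real m + 1) * norm (x - w))"
        using pos by (simp add: field_simps)
      moreover have "\<bar>f x\<bar> \<le> 3 / (1 + K * norm (x - w))"
        using dirichlet_inner_bound[OF x w, of k] K x by (simp add: f_def K_def abs_mult)
      ultimately have "\<bar>f x\<bar> \<le> 3 * real s / (1 + (real m + 1) * norm (x - w))" by simp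
      then have "\<bar>f x\<bar> ^ s \<le> (3 * real s / (1 + (real m + 1) * norm (x - w))) ^ s"
        by (rule power_mono) simp
      moreover have "decay (real m + 1) w x = 1 / (1 + (real m + 1) * norm (x - w)) ^ s"
        unfolding decay_def s_def ..
      ultimately show ?thesis
        using x by (simp add: q_def power_abs power_divide)
    qed
    ultimately show ?thesis by blast
  qed
  moreover have "(3 * real s) ^ s > 0" using s by simp
  ultimately show ?thesis by blast
qed

section \<open>Lagrange interpolation at Fekete points\<close>

lemma independent_family_coeff_zero:
  fixes Q :: "'i \<Rightarrow> 'a \<Rightarrow> real"
  assumes "finite I" "inj_on Q I" "independent (Q ` I)"
    and "\<And>y. (\<Sum>i\<in>I. c i * Q i y) = 0" and "i \<in> I"
  shows "c i = 0"
proof (rule ccontr)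
  assume "c i \<noteq> 0"
  define u where "u v = c (inv_into I Q v)" for v
  have uQ: "u (Q i) = c i" if "i \<in> I" for i using that assms(2) by (simp add: u_def)
  have "(\<Sum>v\<in>Q ` I. u v *\<^sub>R v) = (\<Sum>i\<in>I. c i *\<^sub>R Q i)"
    using assms(2) uQ by (simp add: sum.reindex)
  also have "\<dots> = 0"
  proof
    fix y
    have "(\<Sum>i\<in>I. c i *\<^sub>R Q i) y = (\<Sum>i\<in>I. c i * Q i y)"
      using assms(1) by (induction I rule: finite_induct) (auto simp: scaleR_fun_def)
    with assms(4) show "(\<Sum>i\<in>I. c i *\<^sub>R Q i) y = 0 y" by simp
  qed
  finally have "dependent (Q ` I)"
    unfolding dependent_finite[OF finite_imageI[OF assms(1)]]
    using \<open>c i \<noteq> 0\<close> uQ[OF assms(5)] assms(5) by (intro exI[of _ u]) (auto intro!: bexI[of _ i])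
  with assms(3) show False by simp
qed

text \<open>
  The cofactors along column \<open>j\<close> do not see the entries of that column, so as a function of the
  point \<open>y\<close> placed there the determinant is a fixed linear combination of the functions \<open>Q i\<close>.
\<close>

lemma det_replaced_point_expansion:
  fixes Q :: "nat \<Rightarrow> 'a \<Rightarrow> real" and x :: "nat \<Rightarrow> 'a"
  assumes j: "j < n"
  shows "Determinant.det (Matrix.mat n n (\<lambda>(i, k). Q i ((x(j := y)) k)))
    = (\<Sum>i<n. cofactor (Matrix.mat n n (\<lambda>(i, k). Q i (x k))) i j * Q i y)"
proof -
  let ?A = "Matrix.mat n n (\<lambda>(i, k). Q i ((x(j := y)) k))"
  have "Determinant.det ?A = (\<Sum>i<n. ?A $$ (i, j) * cofactor ?A i j)"
    by (rule laplace_expansion_column) (use j in auto)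
  also have "\<dots> = (\<Sum>i<n. cofactor (Matrix.mat n n (\<lambda>(i, k). Q i (x k))) i j * Q i y)"
  proof (rule sum.cong)
    fix i assume i: "i \<in> {..<n}"
    have "mat_delete ?A i j = mat_delete (Matrix.mat n n (\<lambda>(i, k). Q i (x k))) i j"
      unfolding mat_delete_def by (intro eq_matI) auto
    then show "?A $$ (i, j) * cofactor ?A i j = cofactor (Matrix.mat n n (\<lambda>(i, k). Q i (x k))) i j * Q i y"
      using i j by (simp add: cofactor_def)
  qed simp
  finally show ?thesis .
qed

text \<open>
  Points are added one at a time: if no point made the next determinant nonzero, its expansion
  along the new column would be a vanishing linear combination of the functions, in which the
  coefficient of the last function is the previous nonzero determinant.
\<close>

lemma independent_imp_nonzero_det:
  fixes Q :: "nat \<Rightarrow> 'a \<Rightarrow> real"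
  assumes "inj_on Q {..<n}" "independent (Q ` {..<n})"
    and van: "\<And>i y. i < n \<Longrightarrow> y \<notin> S \<Longrightarrow> Q i y = 0"
  shows "\<exists>x. (\<forall>j<n. x j \<in> S) \<and> Determinant.det (Matrix.mat n n (\<lambda>(i, j). Q i (x j))) \<noteq> 0"
proof -
  have "k \<le> n \<Longrightarrow> \<exists>x. (\<forall>j<k. x j \<in> S) \<and> Determinant.det (Matrix.mat k k (\<lambda>(i, j). Q i (x j))) \<noteq> 0" for k
  proof (induction k)
    case 0
    show ?case by (simp add: det_dim_zero)
  next
    case (Suc k)
    then obtain x where x: "\<forall>j<k. x j \<in> S" and d: "Determinant.det (Matrix.mat k k (\<lambda>(i, j). Q i (x j))) \<noteq> 0"
      by auto
    define A where "A = Matrix.mat (Suc k) (Suc k) (\<lambda>(i, j). Q i (x j))"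
    have "mat_delete A k k = Matrix.mat k k (\<lambda>(i, j). Q i (x j))"
      unfolding A_def mat_delete_def by (intro eq_matI) auto
    then have ck: "cofactor A k k \<noteq> 0" using d by (simp add: cofactor_def)
    have "\<exists>y\<in>S. (\<Sum>i<Suc k. cofactor A i k * Q i y) \<noteq> 0"
    proof (rule ccontr)
      assume "\<not> ?thesis"
      then have zero: "(\<Sum>i<Suc k. cofactor A i k * Q i y) = 0" for y
        using van[of _ y] Suc.prems by (cases "y \<in> S") auto
      have "(\<Sum>i<n. (if i < Suc k then cofactor A i k else 0) * Q i y) = 0" for y
      proof -
        have "(\<Sum>i<n. (if i < Suc k then cofactor A i k else 0) * Q i y) = (\<Sum>i<Suc k. cofactor A i k * Q i y)"
          using Suc.prems by (intro sum.mono_neutral_cong_right) auto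
        with zero show ?thesis by simp
      qed
      from independent_family_coeff_zero[OF finite_lessThan assms(1,2) this, of k]
      show False using ck Suc.prems by simp
    qed
    then obtain y where y: "y \<in> S" "(\<Sum>i<Suc k. cofactor A i k * Q i y) \<noteq> 0" by blast
    then have "Determinant.det (Matrix.mat (Suc k) (Suc k) (\<lambda>(i, j). Q i ((x(k := y)) j))) \<noteq> 0"
      unfolding A_def by (subst det_replaced_point_expansion) auto
    with x y show ?case by (intro exI[of _ "x(k := y)"]) (auto simp: less_Suc_eq)
  qed
  then show ?thesis by blast
qed

text \<open>
  The Lagrange polynomial of \<open>z j\<close> is the quotient of the determinant with \<open>z j\<close> replaced by the
  variable point and the determinant at the Fekete points; maximality of the latter is exactly
  the bound by \<open>1\<close>. Reproduction of polynomials is the identity \<open>A adj(A) = det A\<close>.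
\<close>

lemma fekete_lagrange:
  fixes z :: "nat \<Rightarrow> real ^ 'n"
  assumes "fekete_points L z"
  obtains l :: "nat \<Rightarrow> real ^ 'n \<Rightarrow> real" where
    "\<And>j. j < sph_dim TYPE('n) L \<Longrightarrow> l j \<in> sph_poly L"
    "\<And>j x. j < sph_dim TYPE('n) L \<Longrightarrow> norm x = 1 \<Longrightarrow> \<bar>l j x\<bar> \<le> 1"
    "\<And>i j. i < sph_dim TYPE('n) L \<Longrightarrow> j < sph_dim TYPE('n) L \<Longrightarrow> l j (z i) = (if i = j then 1 else 0)"
    "\<And>f x. f \<in> sph_poly L \<Longrightarrow> f x = (\<Sum>j<sph_dim TYPE('n) L. f (z j) * l j x)"
proof -
  define N where "N = sph_dim TYPE('n) L"
  from assms obtain Q where z: "\<And>j. j < N \<Longrightarrow> z j \<in> sphere 0 1" and Q: "sph_basis L Q"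
    and max: "\<And>x. (\<And>j. j < N \<Longrightarrow> x j \<in> sphere 0 1) \<Longrightarrow> \<bar>fekete_det L Q x\<bar> \<le> \<bar>fekete_det L Q z\<bar>"
    unfolding fekete_points_def N_def by blast
  have inj: "inj_on Q {..<N}" and ind: "independent (Q ` {..<N})" and sp: "span (Q ` {..<N}) = sph_poly L"
    using Q unfolding sph_basis_def N_def by auto
  have QP: "Q i \<in> sph_poly L" if "i < N" for i
    unfolding sp[symmetric] using that by (intro span_base) auto
  obtain x where x: "\<And>j. j < N \<Longrightarrow> x j \<in> sphere 0 1" "Determinant.det (Matrix.mat N N (\<lambda>(i, j). Q i (x j))) \<noteq> 0"
    using independent_imp_nonzero_det[OF inj ind, of "sphere 0 1"] sph_poly_outside[OF QP] by blast
  define A where "A = Matrix.mat N N (\<lambda>(i, j). Q i (z j))"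
  define a where "a = Determinant.det A"
  have a: "a = fekete_det L Q z" by (simp add: a_def A_def fekete_det_def N_def)
  have a0: "a \<noteq> 0"
    using max[OF x(1)] x(2) unfolding a by (auto simp: fekete_det_def N_def)
  define l where "l j y = fekete_det L Q (z(j := y)) / a" for j y
  have l_sum: "l j y = (\<Sum>i<N. (cofactor A i j / a) * Q i y)" if "j < N" for j y
  proof -
    have "fekete_det L Q (z(j := y)) = (\<Sum>i<N. cofactor A i j * Q i y)"
      unfolding fekete_det_def N_def[symmetric] A_def by (rule det_replaced_point_expansion[OF that])
    then show ?thesis by (simp add: l_def sum_divide_distrib)
  qed
  show thesis
  proof (rule that[of l]; (unfold N_def[symmetric])?)
    fix j assume j: "j < N"
    have "(\<lambda>y. \<Sum>i<N. (cofactor A i j / a) * Q i y) \<in> sph_poly L"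
      using QP by (intro sph_poly_sum) auto
    also have "(\<lambda>y. \<Sum>i<N. (cofactor A i j / a) * Q i y) = l j" using l_sum[OF j] by auto
    finally show "l j \<in> sph_poly L" .
  next
    fix j and y :: "real ^ 'n" assume "j < N" "norm y = 1"
    then have "\<bar>fekete_det L Q (z(j := y))\<bar> \<le> \<bar>a\<bar>"
      unfolding a using z by (intro max) auto
    then show "\<bar>l j y\<bar> \<le> 1" using a0 by (simp add: l_def)
  next
    fix i j assume ij: "i < N" "j < N"
    show "l j (z i) = (if i = j then 1 else 0)"
    proof (cases "i = j")
      case True
      then show ?thesis using a0 by (simp add: l_def flip: a)
    next
      case False
      have "fekete_det L Q (z(j := z i)) = 0"
        unfolding fekete_det_def N_def[symmetric]
        by (rule det_identical_columns[OF _ False]) (use ij False in \<open>auto intro!: eq_vecI\<close>)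
      then show ?thesis using False by (simp add: l_def)
    qed
  next
    fix f :: "real ^ 'n \<Rightarrow> real" and y :: "real ^ 'n" assume f: "f \<in> sph_poly L"
    let ?V = "{f :: real ^ 'n \<Rightarrow> real. f y = (\<Sum>j<N. f (z j) * l j y)}"
    have "subspace ?V"
      unfolding subspace_def
      by (auto simp: zero_fun_def plus_fun_def scaleR_fun_def sum.distrib distrib_right mult.assoc
          simp flip: sum_distrib_left)
    moreover have "Q i \<in> ?V" if i: "i < N" for i
    proof -
      have adj: "A * adj_mat A = a \<cdot>\<^sub>m 1\<^sub>m N"
        unfolding a_def by (rule adj_mat) (simp add: A_def)
      have "(\<Sum>j<N. Q i (z j) * cofactor A k j) = (if i = k then a else 0)" if k: "k < N" for k
      proof -
        have "(\<Sum>j<N. Q i (z j) * cofactor A k j) = (A * adj_mat A) $$ (i, k)"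
          using i k by (simp add: A_def adj_mat_def scalar_prod_def lessThan_atLeast0)
        then show ?thesis using i k unfolding adj by simp
      qed
      then have "(\<Sum>k<N. (\<Sum>j<N. Q i (z j) * cofactor A k j) * Q k y / a) = Q i y"
        using i a0 by (simp add: if_distrib[where f = "\<lambda>t. t * _ / _"] cong: if_cong)
      also have "(\<Sum>k<N. (\<Sum>j<N. Q i (z j) * cofactor A k j) * Q k y / a)
          = (\<Sum>k<N. \<Sum>j<N. Q i (z j) * (cofactor A k j / a * Q k y))"
        by (simp add: sum_distrib_right sum_divide_distrib mult.assoc)
      also have "\<dots> = (\<Sum>j<N. Q i (z j) * l j y)"
        by (subst sum.swap) (simp add: l_sum sum_distrib_left)
      finally show ?thesis by simp
    qed
    ultimately have "sph_poly L \<subseteq> ?V"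
      unfolding sp[symmetric] by (intro span_minimal) auto
    with f show "f y = (\<Sum>j<N. f (z j) * l j y)" by blast
  qed
qed

text \<open>
  The Lagrange polynomial of \<open>z j\<close> is bounded by \<open>1\<close> and drops from \<open>1\<close> at \<open>z j\<close> to \<open>0\<close> at \<open>z i\<close>, so
  the Lipschitz estimate keeps the two points apart.
\<close>

lemma fekete_separated:
  fixes z :: "nat \<Rightarrow> real ^ 'n"
  assumes F: "fekete_points L z" and ij: "i < sph_dim TYPE('n) L" "j < sph_dim TYPE('n) L" "i \<noteq> j"
  shows "1 / (7 * (real L + 1)) \<le> norm (z i - z j)"
proof (rule fekete_lagrange[OF F])
  fix l :: "nat \<Rightarrow> real ^ 'n \<Rightarrow> real"
  assume l: "\<And>j. j < sph_dim TYPE('n) L \<Longrightarrow> l j \<in> sph_poly L"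
    "\<And>j x. j < sph_dim TYPE('n) L \<Longrightarrow> norm x = 1 \<Longrightarrow> \<bar>l j x\<bar> \<le> 1"
    "\<And>i j. i < sph_dim TYPE('n) L \<Longrightarrow> j < sph_dim TYPE('n) L \<Longrightarrow> l j (z i) = (if i = j then 1 else 0)"
  have "norm (z i) = 1" "norm (z j) = 1"
    using F ij(1,2) unfolding fekete_points_def by auto
  then have "\<bar>l j (z i) - l j (z j)\<bar> \<le> 7 * (real L + 1) * 1 * norm (z i - z j)"
    using l(1,2)[OF ij(2)] by (intro sph_poly_lipschitz)
  moreover have "l j (z i) = 0" "l j (z j) = 1"
    using l(3)[OF ij(1,2)] l(3)[OF ij(2,2)] ij(3) by auto
  ultimately have "1 \<le> 7 * (real L + 1) * norm (z i - z j)" by simp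
  then show ?thesis by (simp add: divide_le_eq mult.commute)
qed

section \<open>Local estimates for spherical polynomials\<close>

text \<open>
  By the Lipschitz estimate a polynomial of degree \<open>L\<close> stays comparable with its maximum on a
  cap of radius about \<open>1/(L + 1)\<close>, which has measure about \<open>(L + 1)\<^sup>-\<^sup>d\<close>.
\<close>

lemma sph_poly_sup_le_integral:
  obtains C where "C > 0"
    "\<And>L (f :: real ^ 'n \<Rightarrow> real) w. f \<in> sph_poly L \<Longrightarrow> norm w = 1 \<Longrightarrow>
      \<bar>f w\<bar> \<le> C * (real L + 1) ^ (CARD('n) - 1) * (\<integral>x. \<bar>f x\<bar> \<partial>surface_measure)"
proof -
  obtain c where c: "c > 0" and cap: "\<And>(w :: real ^ 'n) r. norm w = 1 \<Longrightarrow> 0 < r \<Longrightarrow> r \<le> 1 \<Longrightarrow>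
      c * r ^ (CARD('n) - 1) \<le> measure surface_measure (cap w r)"
    using surface_measure_cap_lower by blast
  define C where "C = 2 * 14 ^ (CARD('n) - 1) / c"
  show thesis
  proof (rule that[of C])
    show "C > 0" using c by (simp add: C_def)
    fix L and f :: "real ^ 'n \<Rightarrow> real" and w :: "real ^ 'n"
    assume f: "f \<in> sph_poly L" and w: "norm w = 1"
    obtain A where A: "\<And>x. \<bar>f x\<bar> \<le> A" using sph_poly_bounded[OF f] by blast
    define B where "B = (SUP x\<in>sphere 0 1. \<bar>f x\<bar>)"
    have B: "\<bar>f x\<bar> \<le> B" if "norm x = 1" for x
      unfolding B_def using A that by (intro cSUP_upper bdd_aboveI2[of _ _ A]) auto
    define I where "I = (\<integral>x. \<bar>f x\<bar> \<partial>surface_measure)"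
    have int: "integrable surface_measure (\<lambda>x. \<bar>f x\<bar>)"
      using sph_poly_borel_measurable[OF f] A
      by (intro integrable_surface_measure_bounded[of _ A]) auto
    have I0: "I \<ge> 0" unfolding I_def by (intro integral_nonneg_AE AE_I2) auto
    \<comment> \<open>At distance \<open>r\<close> the Lipschitz estimate allows \<open>f\<close> to change by at most \<open>B/2\<close>.\<close>
    define r where "r = 1 / (14 * (real L + 1))"
    have r: "0 < r" "r \<le> 1" by (auto simp: r_def divide_le_eq)
    define b where "b = c * r ^ (CARD('n) - 1)"
    have b: "b > 0" using c r by (simp add: b_def)
    have le: "\<bar>f y\<bar> \<le> B / 2 + I / b" if y: "norm y = 1" for y
    proof (cases "\<bar>f y\<bar> \<ge> B / 2")
      case True
      have "(\<bar>f y\<bar> - B / 2) * b \<le> (\<bar>f y\<bar> - B / 2) * measure surface_measure (cap y r)"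
        using True cap[OF y r] unfolding b_def by (intro mult_left_mono) auto
      also have "\<dots> = (\<integral>x. (\<bar>f y\<bar> - B / 2) * indicator (cap y r) x \<partial>surface_measure)"
        by simp
      also have "\<dots> \<le> I"
        unfolding I_def
      proof (rule integral_mono[OF _ int])
        fix x :: "real ^ 'n" assume "x \<in> space surface_measure"
        then have x: "norm x = 1" by (simp add: space_surface_measure)
        show "(\<bar>f y\<bar> - B / 2) * indicator (cap y r) x \<le> \<bar>f x\<bar>"
        proof (cases "x \<in> cap y r")
          case True
          have B0: "B \<ge> 0" using B[OF x] by simp
          have "\<bar>f y - f x\<bar> \<le> 7 * (real L + 1) * B * norm (y - x)"
            by (rule sph_poly_lipschitz[OF f B y x])
          also have "\<dots> \<le> 7 * (real L + 1) * B * r"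
            using True B0 by (intro mult_left_mono) (auto simp: cap_def dist_norm)
          also have "\<dots> = B / 2" by (simp add: r_def field_simps)
          finally have "\<bar>f y - f x\<bar> \<le> B / 2" .
          then have "\<bar>f y\<bar> - B / 2 \<le> \<bar>f x\<bar>" by linarith
          then show ?thesis using True by simp
        qed simp
      qed (intro integrable_mult_right integrable_cap)
      finally show ?thesis using b by (simp add: field_simps)
    next
      case False
      moreover have "I / b \<ge> 0" using I0 b by simp
      ultimately show ?thesis by simp
    qed
    have "B \<le> B / 2 + I / b"
      unfolding B_def[of] using le w by (intro cSUP_least) (auto simp: B_def)
    then have "B \<le> 2 * (I / b)" by simp
    also have "\<dots> = C * (real L + 1) ^ (CARD('n) - 1) * I"
      using c by (simp add: C_def b_def r_def power_divide power_mult_distrib del: distrib_left_numeral)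
    finally show "\<bar>f w\<bar> \<le> C * (real L + 1) ^ (CARD('n) - 1) * (\<integral>x. \<bar>f x\<bar> \<partial>surface_measure)"
      using B[OF w] by (simp add: I_def)
  qed
qed

text \<open>
  Multiplying by the kernel of degree \<open>M - L\<close> peaked at \<open>w\<close> does not change the value at \<open>w\<close>
  and yields a polynomial of degree \<open>M\<close>; this localises any estimate valid in degree \<open>M\<close>.
\<close>

lemma localise:
  obtains C where "C > 0"
    "\<And>L M (f :: real ^ 'n \<Rightarrow> real) w. f \<in> sph_poly L \<Longrightarrow> L \<le> M \<Longrightarrow> norm w = 1 \<Longrightarrow>
      \<exists>g\<in>sph_poly M. g w = f w \<and> (\<forall>x. norm x = 1 \<longrightarrow> \<bar>g x\<bar> \<le> C * decay (real (M - L) + 1) w x * \<bar>f x\<bar>)"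
proof -
  obtain C where C: "C > 0" and ker: "\<And>m (w :: real ^ 'n). norm w = 1 \<Longrightarrow> \<exists>q\<in>sph_poly m. q w = 1 \<and>
      (\<forall>x. norm x = 1 \<longrightarrow> \<bar>q x\<bar> \<le> C * decay (real m + 1) w x)"
    using localised_kernel by blast
  show thesis
  proof (rule that[OF C])
    fix L M and f :: "real ^ 'n \<Rightarrow> real" and w :: "real ^ 'n"
    assume f: "f \<in> sph_poly L" and LM: "L \<le> M" and w: "norm w = 1"
    obtain q where q: "q \<in> sph_poly (M - L)" "q w = 1"
        "\<And>x. norm x = 1 \<Longrightarrow> \<bar>q x\<bar> \<le> C * decay (real (M - L) + 1) w x"
      using ker[OF w, of "M - L"] by blast
    have "(\<lambda>x. f x * q x) \<in> sph_poly M"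
      using sph_poly_mult[OF f q(1)] LM by simp
    moreover have "\<bar>f x * q x\<bar> \<le> C * decay (real (M - L) + 1) w x * \<bar>f x\<bar>" if "norm x = 1" for x
      using mult_right_mono[OF q(3)[OF that], of "\<bar>f x\<bar>"] by (simp add: abs_mult mult.commute)
    ultimately show "\<exists>g\<in>sph_poly M. g w = f w \<and>
        (\<forall>x. norm x = 1 \<longrightarrow> \<bar>g x\<bar> \<le> C * decay (real (M - L) + 1) w x * \<bar>f x\<bar>)"
      using q(2) by (intro bexI[of _ "\<lambda>x. f x * q x"]) auto
  qed
qed

lemma sph_poly_le_local_mean:
  obtains C where "C > 0"
    "\<And>L M (f :: real ^ 'n \<Rightarrow> real) w. f \<in> sph_poly L \<Longrightarrow> L \<le> M \<Longrightarrow> norm w = 1 \<Longrightarrow>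
      \<bar>f w\<bar> \<le> (\<integral>x. C * (real M + 1) ^ (CARD('n) - 1) * decay (real (M - L) + 1) w x * \<bar>f x\<bar> \<partial>surface_measure)"
proof -
  obtain C1 where C1: "C1 > 0" "\<And>L (f :: real ^ 'n \<Rightarrow> real) w. f \<in> sph_poly L \<Longrightarrow> norm w = 1 \<Longrightarrow>
      \<bar>f w\<bar> \<le> C1 * (real L + 1) ^ (CARD('n) - 1) * (\<integral>x. \<bar>f x\<bar> \<partial>surface_measure)"
    by (rule sph_poly_sup_le_integral[where 'n = 'n]) (rule that; blast)
  obtain C2 where C2: "C2 > 0" "\<And>L M (f :: real ^ 'n \<Rightarrow> real) w. f \<in> sph_poly L \<Longrightarrow> L \<le> M \<Longrightarrow> norm w = 1 \<Longrightarrow>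
      \<exists>g\<in>sph_poly M. g w = f w \<and> (\<forall>x. norm x = 1 \<longrightarrow> \<bar>g x\<bar> \<le> C2 * decay (real (M - L) + 1) w x * \<bar>f x\<bar>)"
    by (rule localise[where 'n = 'n]) (rule that; blast)
  show thesis
  proof (rule that[of "C1 * C2"])
    show "C1 * C2 > 0" using C1 C2 by simp
    fix L M and f :: "real ^ 'n \<Rightarrow> real" and w :: "real ^ 'n"
    assume f: "f \<in> sph_poly L" and LM: "L \<le> M" and w: "norm w = 1"
    define n where "n = real (M - L) + 1"
    obtain g where g: "g \<in> sph_poly M" "g w = f w" "\<And>x. norm x = 1 \<Longrightarrow> \<bar>g x\<bar> \<le> C2 * decay n w x * \<bar>f x\<bar>"
      using C2(2)[OF f LM w] unfolding n_def by blast
    obtain A where A: "A \<ge> 0" "\<And>x. \<bar>f x\<bar> \<le> A" by (rule sph_poly_bounded[OF f]) auto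
    obtain B where B: "B \<ge> 0" "\<And>x. \<bar>g x\<bar> \<le> B" by (rule sph_poly_bounded[OF g(1)]) auto
    have "(\<integral>x. \<bar>g x\<bar> \<partial>surface_measure) \<le> (\<integral>x. C2 * (decay n w x * \<bar>f x\<bar>) \<partial>surface_measure)"
    proof (rule integral_mono)
      show "integrable surface_measure (\<lambda>x. \<bar>g x\<bar>)"
        using sph_poly_borel_measurable[OF g(1)] B
        by (intro integrable_surface_measure_bounded[of _ B]) auto
      have "\<bar>decay n w x * \<bar>f x\<bar>\<bar> \<le> 1 * A" for x
        unfolding abs_mult abs_abs using A decay_pos[of n w x] decay_le_1[of n w x]
        by (intro mult_mono) (auto simp: n_def)
      then show "integrable surface_measure (\<lambda>x. C2 * (decay n w x * \<bar>f x\<bar>))"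
        using sph_poly_borel_measurable[OF f] decay_borel[of n w]
        by (intro integrable_mult_right integrable_surface_measure_bounded[of _ "1 * A"]) auto
    qed (use g in \<open>auto simp: space_surface_measure mult.assoc\<close>)
    then have "C1 * (real M + 1) ^ (CARD('n) - 1) * (\<integral>x. \<bar>g x\<bar> \<partial>surface_measure)
        \<le> C1 * (real M + 1) ^ (CARD('n) - 1) * (\<integral>x. C2 * (decay n w x * \<bar>f x\<bar>) \<partial>surface_measure)"
      using C1 by (intro mult_left_mono) auto
    with C1(2)[OF g(1) w] g(2) have "\<bar>f w\<bar>
        \<le> C1 * (real M + 1) ^ (CARD('n) - 1) * (\<integral>x. C2 * (decay n w x * \<bar>f x\<bar>) \<partial>surface_measure)"
      by simp
    also have "\<dots> = (\<integral>x. C1 * (real M + 1) ^ (CARD('n) - 1) * (C2 * (decay n w x * \<bar>f x\<bar>)) \<partial>surface_measure)"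
      by (rule integral_mult_right_zero[symmetric])
    also have "\<dots> = (\<integral>x. C1 * C2 * (real M + 1) ^ (CARD('n) - 1) * decay (real (M - L) + 1) w x * \<bar>f x\<bar> \<partial>surface_measure)"
      by (intro Bochner_Integration.integral_cong) (simp_all add: n_def mult_ac)
    finally show "\<bar>f w\<bar> \<le> (\<integral>x. C1 * C2 * (real M + 1) ^ (CARD('n) - 1) * decay (real (M - L) + 1) w x * \<bar>f x\<bar> \<partial>surface_measure)" .
  qed
qed

text \<open>
  The localised polynomial has degree at most \<open>M\<close>, so it is reproduced exactly by interpolation at
  the Fekete points, and the Lagrange polynomials are bounded by \<open>1\<close>.
\<close>

lemma sph_poly_le_local_sum:
  obtains C where "C > 0"
    "\<And>L M z (f :: real ^ 'n \<Rightarrow> real) w. f \<in> sph_poly L \<Longrightarrow> L \<le> M \<Longrightarrow> fekete_points M z \<Longrightarrow> norm w = 1 \<Longrightarrow>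
      \<bar>f w\<bar> \<le> (\<Sum>j<sph_dim TYPE('n) M. C * decay (real (M - L) + 1) w (z j) * \<bar>f (z j)\<bar>)"
proof -
  obtain C where C: "C > 0" "\<And>L M (f :: real ^ 'n \<Rightarrow> real) w. f \<in> sph_poly L \<Longrightarrow> L \<le> M \<Longrightarrow> norm w = 1 \<Longrightarrow>
      \<exists>g\<in>sph_poly M. g w = f w \<and> (\<forall>x. norm x = 1 \<longrightarrow> \<bar>g x\<bar> \<le> C * decay (real (M - L) + 1) w x * \<bar>f x\<bar>)"
    by (rule localise[where 'n = 'n]) (rule that; blast)
  show thesis
  proof (rule that[OF C(1)])
    fix L M and z :: "nat \<Rightarrow> real ^ 'n" and f :: "real ^ 'n \<Rightarrow> real" and w :: "real ^ 'n"
    assume f: "f \<in> sph_poly L" and LM: "L \<le> M" and z: "fekete_points M z" and w: "norm w = 1"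
    define n where "n = real (M - L) + 1"
    obtain g where g: "g \<in> sph_poly M" "g w = f w" "\<And>x. norm x = 1 \<Longrightarrow> \<bar>g x\<bar> \<le> C * decay n w x * \<bar>f x\<bar>"
      using C(2)[OF f LM w] unfolding n_def by blast
    show "\<bar>f w\<bar> \<le> (\<Sum>j<sph_dim TYPE('n) M. C * decay (real (M - L) + 1) w (z j) * \<bar>f (z j)\<bar>)"
    proof (rule fekete_lagrange[OF z])
      fix l :: "nat \<Rightarrow> real ^ 'n \<Rightarrow> real"
      assume l_le: "\<And>j x. j < sph_dim TYPE('n) M \<Longrightarrow> norm x = 1 \<Longrightarrow> \<bar>l j x\<bar> \<le> 1"
        and repr: "\<And>f x. f \<in> sph_poly M \<Longrightarrow> f x = (\<Sum>j<sph_dim TYPE('n) M. f (z j) * l j x)"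
      have "\<bar>f w\<bar> = \<bar>\<Sum>j<sph_dim TYPE('n) M. g (z j) * l j w\<bar>"
        using repr[OF g(1), of w] g(2) by simp
      also have "\<dots> \<le> (\<Sum>j<sph_dim TYPE('n) M. \<bar>g (z j) * l j w\<bar>)" by (rule sum_abs)
      also have "\<dots> \<le> (\<Sum>j<sph_dim TYPE('n) M. C * decay n w (z j) * \<bar>f (z j)\<bar>)"
      proof (rule sum_mono)
        fix j assume j: "j \<in> {..<sph_dim TYPE('n) M}"
        then have "norm (z j) = 1" using z unfolding fekete_points_def by auto
        from g(3)[OF this] have "\<bar>g (z j)\<bar> * \<bar>l j w\<bar> \<le> C * decay n w (z j) * \<bar>f (z j)\<bar> * 1"
          using l_le[of j w] j w by (intro mult_mono) (auto intro: order_trans[OF abs_ge_zero])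
        then show "\<bar>g (z j) * l j w\<bar> \<le> C * decay n w (z j) * \<bar>f (z j)\<bar>" by (simp add: abs_mult)
      qed
      finally show ?thesis unfolding n_def .
    qed
  qed
qed

section \<open>The number of Fekete points\<close>

lemma fekete_sum_decay_le:
  obtains C where "C > 0"
    "\<And>M z (w :: real ^ 'n) n. fekete_points M z \<Longrightarrow> norm w = 1 \<Longrightarrow> 1 \<le> n \<Longrightarrow> n \<le> real M + 1 \<Longrightarrow>
      (\<Sum>j<sph_dim TYPE('n) M. decay n w (z j)) \<le> C * ((real M + 1) / n) ^ (CARD('n) - 1)"
proof -
  obtain C where C: "C > 0" and sum: "\<And>(w :: real ^ 'n) n \<delta> (z :: nat \<Rightarrow> real ^ 'n) J.
    norm w = 1 \<Longrightarrow> n \<ge> 1 \<Longrightarrow> 0 < \<delta> \<Longrightarrow> n * \<delta> \<le> 1 \<Longrightarrow> finite J \<Longrightarrow>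
    (\<forall>j\<in>J. norm (z j) = 1) \<Longrightarrow> (\<forall>i\<in>J. \<forall>j\<in>J. i \<noteq> j \<longrightarrow> \<delta> \<le> norm (z i - z j)) \<Longrightarrow>
    (\<Sum>j\<in>J. decay n w (z j)) \<le> C / (n * \<delta>) ^ (CARD('n) - 1)"
    using sum_decay_separated_le[where 'n = 'n] by auto
  show thesis
  proof (rule that[of "C * 7 ^ (CARD('n) - 1)"])
    show "C * 7 ^ (CARD('n) - 1) > 0" using C by simp
    fix M and z :: "nat \<Rightarrow> real ^ 'n" and w :: "real ^ 'n" and n :: real
    assume z: "fekete_points M z" and w: "norm w = 1" and n: "1 \<le> n" "n \<le> real M + 1"
    define \<delta> where "\<delta> = 1 / (7 * (real M + 1))"
    have "n * \<delta> \<le> 1" using n by (simp add: \<delta>_def)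
    moreover have "\<forall>j\<in>{..<sph_dim TYPE('n) M}. norm (z j) = 1"
      using z unfolding fekete_points_def by auto
    ultimately have "(\<Sum>j<sph_dim TYPE('n) M. decay n w (z j)) \<le> C / (n * \<delta>) ^ (CARD('n) - 1)"
      using fekete_separated[OF z] by (intro sum w n) (auto simp: \<delta>_def)
    also have "\<dots> = C * 7 ^ (CARD('n) - 1) * ((real M + 1) / n) ^ (CARD('n) - 1)"
      by (simp add: \<delta>_def power_divide power_mult_distrib del: distrib_left_numeral)
    finally show "(\<Sum>j<sph_dim TYPE('n) M. decay n w (z j)) \<le> C * 7 ^ (CARD('n) - 1) * ((real M + 1) / n) ^ (CARD('n) - 1)" .
  qed
qed

lemma unit_vector_exists: "\<exists>w :: real ^ 'n. norm w = 1"
  using vector_choose_size[of 1] by auto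

text \<open>
  Every weight of scale \<open>1\<close> is bounded below on the sphere, so the preceding sum counts points.
\<close>

lemma sph_dim_upper:
  obtains C where "C > 0"
    "\<And>M (z :: nat \<Rightarrow> real ^ 'n). fekete_points M z \<Longrightarrow>
      real (sph_dim TYPE('n) M) \<le> C * (real M + 1) ^ (CARD('n) - 1)"
proof -
  obtain C where C: "C > 0" "\<And>M z (w :: real ^ 'n) n. fekete_points M z \<Longrightarrow> norm w = 1 \<Longrightarrow> 1 \<le> n \<Longrightarrow> n \<le> real M + 1 \<Longrightarrow>
      (\<Sum>j<sph_dim TYPE('n) M. decay n w (z j)) \<le> C * ((real M + 1) / n) ^ (CARD('n) - 1)"
    by (rule fekete_sum_decay_le[where 'n = 'n]) (rule that; blast)
  obtain w :: "real ^ 'n" where w: "norm w = 1" using unit_vector_exists by blast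
  show thesis
  proof (rule that[of "3 ^ (CARD('n) + 1) * C"])
    show "3 ^ (CARD('n) + 1) * C > 0" using C by simp
    fix M and z :: "nat \<Rightarrow> real ^ 'n" assume z: "fekete_points M z"
    have "1 \<le> 3 ^ (CARD('n) + 1) * decay 1 w (z j)" if "j < sph_dim TYPE('n) M" for j
    proof -
      have "norm (z j) = 1" using z that unfolding fekete_points_def by auto
      then have "norm (z j - w) \<le> 2" using norm_triangle_ineq4[of "z j" w] w by simp
      then have "(1 + 1 * norm (z j - w)) ^ (CARD('n) + 1) \<le> 3 ^ (CARD('n) + 1)"
        by (intro power_mono) auto
      moreover have "(1 + 1 * norm (z j - w)) ^ (CARD('n) + 1) > 0"
        by (intro zero_less_power add_pos_nonneg) auto
      ultimately show ?thesis unfolding decay_def by (subst times_divide_eq_right, subst pos_le_divide_eq) auto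
    qed
    then have "(\<Sum>j<sph_dim TYPE('n) M. 1) \<le> (\<Sum>j<sph_dim TYPE('n) M. 3 ^ (CARD('n) + 1) * decay 1 w (z j))"
      by (intro sum_mono) auto
    also have "\<dots> \<le> 3 ^ (CARD('n) + 1) * (C * (real M + 1) ^ (CARD('n) - 1))"
      unfolding sum_distrib_left[symmetric] using C(2)[OF z w, of 1] by (intro mult_left_mono) auto
    finally show "real (sph_dim TYPE('n) M) \<le> 3 ^ (CARD('n) + 1) * C * (real M + 1) ^ (CARD('n) - 1)"
      by (simp add: mult.assoc)
  qed
qed

text \<open>
  Reproduction of the constant \<open>1\<close> forces the weights of scale \<open>1/(M + 1)\<close> around the Fekete points
  to cover the sphere; each has integral of order \<open>(M + 1)\<^sup>-\<^sup>d\<close>.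
\<close>

lemma sph_dim_lower:
  obtains c where "c > 0"
    "\<And>M (z :: nat \<Rightarrow> real ^ 'n). fekete_points M z \<Longrightarrow>
      c * (real M + 1) ^ (CARD('n) - 1) \<le> real (sph_dim TYPE('n) M)"
proof -
  obtain C1 where C1: "C1 > 0"
    "\<And>L M z (f :: real ^ 'n \<Rightarrow> real) w. f \<in> sph_poly L \<Longrightarrow> L \<le> M \<Longrightarrow> fekete_points M z \<Longrightarrow> norm w = 1 \<Longrightarrow>
      \<bar>f w\<bar> \<le> (\<Sum>j<sph_dim TYPE('n) M. C1 * decay (real (M - L) + 1) w (z j) * \<bar>f (z j)\<bar>)"
    by (rule sph_poly_le_local_sum[where 'n = 'n]) (rule that; blast)
  obtain C2 where C2: "C2 > 0" and int: "\<And>(w :: real ^ 'n) n. norm w = 1 \<Longrightarrow> n \<ge> 1 \<Longrightarrow>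
      (\<integral>x. decay n w x \<partial>surface_measure) \<le> C2 / n ^ (CARD('n) - 1)"
    using integral_decay_le by blast
  obtain c where c: "c > 0" and cap: "\<And>(w :: real ^ 'n) r. norm w = 1 \<Longrightarrow> 0 < r \<Longrightarrow> r \<le> 1 \<Longrightarrow>
      c * r ^ (CARD('n) - 1) \<le> measure surface_measure (cap w r)"
    using surface_measure_cap_lower by blast
  obtain w :: "real ^ 'n" where w: "norm w = 1" using unit_vector_exists by blast
  define s where "s = measure surface_measure (space (surface_measure :: (real ^ 'n) measure))"
  have "c \<le> measure surface_measure (cap w 1)" using cap[OF w, of 1] by simp
  also have "\<dots> \<le> s" unfolding s_def by (rule surface_measure.bounded_measure)
  finally have s: "s > 0" using c by simp
  show thesis
  proof (rule that[of "s / (C1 * C2)"])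
    show "s / (C1 * C2) > 0" using s C1 C2 by simp
    fix M and z :: "nat \<Rightarrow> real ^ 'n" assume z: "fekete_points M z"
    let ?n = "real M + 1" and ?D = "sph_dim TYPE('n) M"
    have nz: "norm (z j) = 1" if "j < ?D" for j
      using z that unfolding fekete_points_def by auto
    have pt: "1 \<le> (\<Sum>j<?D. C1 * decay ?n (z j) w)" if w: "norm w = 1" for w
    proof -
      have "\<bar>if w \<in> sphere 0 1 then 1 else 0 :: real\<bar>
          \<le> (\<Sum>j<?D. C1 * decay (real (M - 0) + 1) w (z j) * \<bar>if z j \<in> sphere 0 1 then 1 else 0\<bar>)"
        by (rule C1(2)[OF sph_poly_const _ z w]) simp
      also have "\<dots> = (\<Sum>j<?D. C1 * decay ?n (z j) w)"
        using nz by (intro sum.cong) (auto simp: decay_commute)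
      finally show ?thesis using w by simp
    qed
    have "s = (\<integral>x. 1 \<partial>(surface_measure :: (real ^ 'n) measure))" by (simp add: s_def)
    also have "\<dots> \<le> (\<integral>x. (\<Sum>j<?D. C1 * decay ?n (z j) x) \<partial>surface_measure)"
      by (intro integral_mono pt Bochner_Integration.integrable_sum integrable_mult_right integrable_decay)
         (auto simp: space_surface_measure)
    also have "\<dots> = (\<Sum>j<?D. C1 * (\<integral>x. decay ?n (z j) x \<partial>surface_measure))"
      by (subst Bochner_Integration.integral_sum) (auto intro!: integrable_decay)
    also have "\<dots> \<le> (\<Sum>j<?D. C1 * (C2 / ?n ^ (CARD('n) - 1)))"
      using C1(1) nz by (intro sum_mono mult_left_mono int) auto
    also have "\<dots> = real ?D * (C1 * C2) / ?n ^ (CARD('n) - 1)" by simp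
    finally have "s * ?n ^ (CARD('n) - 1) \<le> real ?D * (C1 * C2)"
      by (subst (asm) pos_le_divide_eq) auto
    then show "s / (C1 * C2) * ?n ^ (CARD('n) - 1) \<le> real ?D"
      using C1 C2 by (simp add: pos_divide_le_eq)
  qed
qed

lemma sph_dim_mono:
  fixes y z :: "nat \<Rightarrow> real ^ 'n"
  assumes "fekete_points L y" "fekete_points M z" "L \<le> M"
  shows "sph_dim TYPE('n) L \<le> sph_dim TYPE('n) M"
proof -
  let ?I = "{..<sph_dim TYPE('n) L}" and ?J = "{..<sph_dim TYPE('n) M}"
  obtain P Q :: "nat \<Rightarrow> real ^ 'n \<Rightarrow> real" where P: "sph_basis L P" and Q: "sph_basis M Q"
    using assms unfolding fekete_points_def by blast
  have "P ` ?I \<subseteq> span (P ` ?I)" by (rule span_superset)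
  also have "\<dots> \<subseteq> span (Q ` ?J)"
    using P Q sph_poly_mono[OF assms(3)] unfolding sph_basis_def by auto
  finally have "card (P ` ?I) \<le> card (Q ` ?J)"
    using P unfolding sph_basis_def by (intro conjunct2[OF independent_span_bound]) auto
  then show ?thesis using P Q unfolding sph_basis_def by (simp add: card_image)
qed

section \<open>Sampling inequalities\<close>

text \<open>
  The hypothesis \<open>M + 1 \<le> \<kappa> (M - L + 1)\<close> says that the degree \<open>M\<close> of the Fekete points exceeds
  \<open>L\<close> by a fixed proportion, so that the scales \<open>1/(M - L + 1)\<close> of the kernel and \<open>1/(M + 1)\<close> of
  the points are comparable.
\<close>

lemma fekete_total_weight_le:
  fixes \<kappa> :: real
  assumes "\<kappa> > 0"
  obtains W where "W > 0"
    "\<And>L M z (w :: real ^ 'n). L \<le> M \<Longrightarrow> real M + 1 \<le> \<kappa> * (real (M - L) + 1) \<Longrightarrow>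
      fekete_points M z \<Longrightarrow> norm w = 1 \<Longrightarrow>
      (\<Sum>j<sph_dim TYPE('n) M. decay (real (M - L) + 1) w (z j)) \<le> W"
proof -
  obtain C where C: "C > 0" "\<And>M z (w :: real ^ 'n) n. fekete_points M z \<Longrightarrow> norm w = 1 \<Longrightarrow> 1 \<le> n \<Longrightarrow> n \<le> real M + 1 \<Longrightarrow>
      (\<Sum>j<sph_dim TYPE('n) M. decay n w (z j)) \<le> C * ((real M + 1) / n) ^ (CARD('n) - 1)"
    by (rule fekete_sum_decay_le[where 'n = 'n]) (rule that; blast)
  show thesis
  proof (rule that[of "C * \<kappa> ^ (CARD('n) - 1)"])
    show "C * \<kappa> ^ (CARD('n) - 1) > 0" using C assms by simp
    fix L M and z :: "nat \<Rightarrow> real ^ 'n" and w :: "real ^ 'n"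
    assume LM: "L \<le> M" and \<kappa>: "real M + 1 \<le> \<kappa> * (real (M - L) + 1)"
      and z: "fekete_points M z" and w: "norm w = 1"
    have "(\<Sum>j<sph_dim TYPE('n) M. decay (real (M - L) + 1) w (z j))
        \<le> C * ((real M + 1) / (real (M - L) + 1)) ^ (CARD('n) - 1)"
      by (rule C(2)[OF z w]) auto
    also have "\<dots> \<le> C * \<kappa> ^ (CARD('n) - 1)"
      using C \<kappa> by (intro mult_left_mono power_mono) (auto simp: divide_le_eq)
    finally show "(\<Sum>j<sph_dim TYPE('n) M. decay (real (M - L) + 1) w (z j)) \<le> C * \<kappa> ^ (CARD('n) - 1)" .
  qed
qed

lemma integral_decay_scaled_le:
  fixes \<kappa> :: real
  assumes "\<kappa> > 0"
  obtains C where "C > 0"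
    "\<And>L M (w :: real ^ 'n). real M + 1 \<le> \<kappa> * (real (M - L) + 1) \<Longrightarrow> norm w = 1 \<Longrightarrow>
      (real M + 1) ^ (CARD('n) - 1) * (\<integral>x. decay (real (M - L) + 1) w x \<partial>surface_measure) \<le> C"
proof -
  obtain C where C: "C > 0" and int: "\<And>(w :: real ^ 'n) n. norm w = 1 \<Longrightarrow> n \<ge> 1 \<Longrightarrow>
      (\<integral>x. decay n w x \<partial>surface_measure) \<le> C / n ^ (CARD('n) - 1)"
    using integral_decay_le by blast
  show thesis
  proof (rule that[of "C * \<kappa> ^ (CARD('n) - 1)"])
    show "C * \<kappa> ^ (CARD('n) - 1) > 0" using C assms by simp
    fix L M and w :: "real ^ 'n"
    assume \<kappa>: "real M + 1 \<le> \<kappa> * (real (M - L) + 1)" and w: "norm w = 1"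
    define n where "n = real (M - L) + 1"
    have "(real M + 1) ^ (CARD('n) - 1) * (\<integral>x. decay n w x \<partial>surface_measure)
        \<le> (\<kappa> * n) ^ (CARD('n) - 1) * (C / n ^ (CARD('n) - 1))"
      using \<kappa> assms decay_pos[of n w]
      by (intro mult_mono power_mono int w integral_nonneg_AE AE_I2) (auto simp: n_def intro: less_imp_le)
    also have "\<dots> = C * \<kappa> ^ (CARD('n) - 1)"
      by (simp add: power_mult_distrib n_def)
    finally show "(real M + 1) ^ (CARD('n) - 1) * (\<integral>x. decay (real (M - L) + 1) w x \<partial>surface_measure)
        \<le> C * \<kappa> ^ (CARD('n) - 1)" unfolding n_def .
  qed
qed

lemma integrable_decay_powr:
  fixes f :: "real ^ 'n \<Rightarrow> real"
  assumes "f \<in> sph_poly L" "n \<ge> 0" "p \<ge> 0"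
  shows "integrable surface_measure (\<lambda>x. decay n w x * \<bar>f x\<bar> powr p)"
proof -
  obtain A where A: "A \<ge> 0" "\<And>x. \<bar>f x\<bar> \<le> A" by (rule sph_poly_bounded[OF assms(1)]) auto
  have "\<bar>decay n w x * \<bar>f x\<bar> powr p\<bar> \<le> 1 * A powr p" for x
    unfolding abs_mult using assms A decay_pos[of n w x] decay_le_1[of n w x]
    by (intro mult_mono) (auto intro: powr_mono2)
  then show ?thesis
    using sph_poly_borel_measurable[OF assms(1)] decay_borel[of n w]
    by (intro integrable_surface_measure_bounded[of _ "1 * A powr p"]) auto
qed

lemma integrable_sph_poly_powr:
  fixes f :: "real ^ 'n \<Rightarrow> real"
  assumes "f \<in> sph_poly L" "p \<ge> 0"
  shows "integrable surface_measure (\<lambda>x. \<bar>f x\<bar> powr p)"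
  using integrable_decay_powr[OF assms(1) order_refl assms(2), of 0] by (simp add: decay_def)

lemma integrable_decay_abs:
  fixes f :: "real ^ 'n \<Rightarrow> real"
  assumes "f \<in> sph_poly L" "n \<ge> 0"
  shows "integrable surface_measure (\<lambda>x. decay n w x * \<bar>f x\<bar>)"
  using integrable_decay_powr[OF assms, of 1 w] by simp

lemma sph_poly_sup_le_samples:
  fixes \<kappa> :: real
  assumes "\<kappa> > 0"
  obtains C where "C > 0"
    "\<And>L M z (f :: real ^ 'n \<Rightarrow> real) w B. f \<in> sph_poly L \<Longrightarrow> L \<le> M \<Longrightarrow>
      real M + 1 \<le> \<kappa> * (real (M - L) + 1) \<Longrightarrow> fekete_points M z \<Longrightarrow> norm w = 1 \<Longrightarrow> 0 \<le> B \<Longrightarrow>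
      (\<And>j. j < sph_dim TYPE('n) M \<Longrightarrow> \<bar>f (z j)\<bar> \<le> B) \<Longrightarrow> \<bar>f w\<bar> \<le> C * B"
proof -
  obtain C where C: "C > 0"
    "\<And>L M z (f :: real ^ 'n \<Rightarrow> real) w. f \<in> sph_poly L \<Longrightarrow> L \<le> M \<Longrightarrow> fekete_points M z \<Longrightarrow> norm w = 1 \<Longrightarrow>
      \<bar>f w\<bar> \<le> (\<Sum>j<sph_dim TYPE('n) M. C * decay (real (M - L) + 1) w (z j) * \<bar>f (z j)\<bar>)"
    by (rule sph_poly_le_local_sum[where 'n = 'n]) (rule that; blast)
  obtain W where W: "W > 0"
    "\<And>L M z (w :: real ^ 'n). L \<le> M \<Longrightarrow> real M + 1 \<le> \<kappa> * (real (M - L) + 1) \<Longrightarrow>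
      fekete_points M z \<Longrightarrow> norm w = 1 \<Longrightarrow>
      (\<Sum>j<sph_dim TYPE('n) M. decay (real (M - L) + 1) w (z j)) \<le> W"
    by (rule fekete_total_weight_le[OF assms, where 'n = 'n]) (rule that; blast)
  show thesis
  proof (rule that[of "C * W"])
    show "C * W > 0" using C W by simp
    fix L M and z :: "nat \<Rightarrow> real ^ 'n" and f :: "real ^ 'n \<Rightarrow> real" and w :: "real ^ 'n" and B :: real
    assume f: "f \<in> sph_poly L" and LM: "L \<le> M" and \<kappa>: "real M + 1 \<le> \<kappa> * (real (M - L) + 1)"
      and z: "fekete_points M z" and w: "norm w = 1" and B: "0 \<le> B"
        "\<And>j. j < sph_dim TYPE('n) M \<Longrightarrow> \<bar>f (z j)\<bar> \<le> B"
    have "\<bar>f w\<bar> \<le> (\<Sum>j<sph_dim TYPE('n) M. C * decay (real (M - L) + 1) w (z j) * \<bar>f (z j)\<bar>)"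
      by (rule C(2)[OF f LM z w])
    also have "\<dots> \<le> (\<Sum>j<sph_dim TYPE('n) M. C * decay (real (M - L) + 1) w (z j) * B)"
      using B C(1) by (intro sum_mono mult_left_mono mult_nonneg_nonneg less_imp_le[OF decay_pos]) auto
    also have "\<dots> = C * (\<Sum>j<sph_dim TYPE('n) M. decay (real (M - L) + 1) w (z j)) * B"
      by (simp add: sum_distrib_left sum_distrib_right)
    also have "\<dots> \<le> C * W * B"
      using C(1) B by (intro mult_right_mono mult_left_mono W(2)[OF LM \<kappa> z w]) auto
    finally show "\<bar>f w\<bar> \<le> C * W * B" .
  qed
qed

text \<open>
  At each point \<open>w\<close> the value of \<open>f\<close> is bounded by a weighted sum of samples with bounded total
  weight. Jensen's inequality moves the power \<open>p\<close> inside, and then each sample is multiplied only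
  by the integral over \<open>w\<close> of its weight, which is of order \<open>(M + 1)\<^sup>-\<^sup>d\<close>.
\<close>

lemma sph_poly_Lp_le_samples:
  fixes \<kappa> p :: real
  assumes "\<kappa> > 0" and p: "p \<ge> 1"
  obtains C where "C > 0"
    "\<And>L M z (f :: real ^ 'n \<Rightarrow> real). f \<in> sph_poly L \<Longrightarrow> L \<le> M \<Longrightarrow>
      real M + 1 \<le> \<kappa> * (real (M - L) + 1) \<Longrightarrow> fekete_points M z \<Longrightarrow>
      (real M + 1) ^ (CARD('n) - 1) * (\<integral>w. \<bar>f w\<bar> powr p \<partial>surface_measure)
        \<le> C * (\<Sum>j<sph_dim TYPE('n) M. \<bar>f (z j)\<bar> powr p)"
proof -
  obtain C where C: "C > 0"
    "\<And>L M z (f :: real ^ 'n \<Rightarrow> real) w. f \<in> sph_poly L \<Longrightarrow> L \<le> M \<Longrightarrow> fekete_points M z \<Longrightarrow> norm w = 1 \<Longrightarrow>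
      \<bar>f w\<bar> \<le> (\<Sum>j<sph_dim TYPE('n) M. C * decay (real (M - L) + 1) w (z j) * \<bar>f (z j)\<bar>)"
    by (rule sph_poly_le_local_sum[where 'n = 'n]) (rule that; blast)
  obtain W where W: "W > 0"
    "\<And>L M z (w :: real ^ 'n). L \<le> M \<Longrightarrow> real M + 1 \<le> \<kappa> * (real (M - L) + 1) \<Longrightarrow>
      fekete_points M z \<Longrightarrow> norm w = 1 \<Longrightarrow>
      (\<Sum>j<sph_dim TYPE('n) M. decay (real (M - L) + 1) w (z j)) \<le> W"
    by (rule fekete_total_weight_le[OF assms(1), where 'n = 'n]) (rule that; blast)
  obtain I where I: "I > 0"
    "\<And>L M (w :: real ^ 'n). real M + 1 \<le> \<kappa> * (real (M - L) + 1) \<Longrightarrow> norm w = 1 \<Longrightarrow>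
      (real M + 1) ^ (CARD('n) - 1) * (\<integral>x. decay (real (M - L) + 1) w x \<partial>surface_measure) \<le> I"
    by (rule integral_decay_scaled_le[OF assms(1), where 'n = 'n]) (rule that; blast)
  define K where "K = (C * W) powr (p - 1) * C"
  have K: "K > 0" using C W by (simp add: K_def)
  show thesis
  proof (rule that[of "K * I"])
    show "K * I > 0" using K I by simp
    fix L M and z :: "nat \<Rightarrow> real ^ 'n" and f :: "real ^ 'n \<Rightarrow> real"
    assume f: "f \<in> sph_poly L" and LM: "L \<le> M" and \<kappa>: "real M + 1 \<le> \<kappa> * (real (M - L) + 1)"
      and z: "fekete_points M z"
    define n where "n = real (M - L) + 1"
    define a where "a = (real M + 1) ^ (CARD('n) - 1)"
    let ?D = "sph_dim TYPE('n) M"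
    have n0: "n \<ge> 0" by (simp add: n_def)
    have nz: "norm (z j) = 1" if "j < ?D" for j
      using z that unfolding fekete_points_def by auto
    have pt: "\<bar>f w\<bar> powr p \<le> (\<Sum>j<?D. K * \<bar>f (z j)\<bar> powr p * decay n (z j) w)" if w: "norm w = 1" for w
    proof -
      have "\<bar>f w\<bar> powr p \<le> (\<Sum>j<?D. C * decay n w (z j) * \<bar>f (z j)\<bar>) powr p"
        using C(2)[OF f LM z w] p unfolding n_def by (intro powr_mono2) auto
      also have "\<dots> \<le> (C * W) powr (p - 1) * (\<Sum>j<?D. C * decay n w (z j) * \<bar>f (z j)\<bar> powr p)"
        using p C W W(2)[OF LM \<kappa> z w] n0 unfolding n_def[symmetric]
        by (intro weighted_jensen_powr_sum) (auto simp: less_imp_le[OF decay_pos] simp flip: sum_distrib_left)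
      also have "\<dots> = (\<Sum>j<?D. K * \<bar>f (z j)\<bar> powr p * decay n (z j) w)"
        unfolding sum_distrib_left by (intro sum.cong) (auto simp: K_def mult_ac decay_commute)
      finally show ?thesis .
    qed
    have "(\<integral>w. \<bar>f w\<bar> powr p \<partial>surface_measure) \<le> (\<integral>w. (\<Sum>j<?D. K * \<bar>f (z j)\<bar> powr p * decay n (z j) w) \<partial>surface_measure)"
      using f p n0
      by (intro integral_mono pt integrable_sph_poly_powr Bochner_Integration.integrable_sum
          integrable_mult_right integrable_decay) (auto simp: space_surface_measure)
    also have "\<dots> = (\<Sum>j<?D. K * \<bar>f (z j)\<bar> powr p * (\<integral>w. decay n (z j) w \<partial>surface_measure))"
      using n0 by (subst Bochner_Integration.integral_sum) (auto intro!: integrable_decay)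
    finally have "a * (\<integral>w. \<bar>f w\<bar> powr p \<partial>surface_measure)
        \<le> a * (\<Sum>j<?D. K * \<bar>f (z j)\<bar> powr p * (\<integral>w. decay n (z j) w \<partial>surface_measure))"
      by (intro mult_left_mono) (auto simp: a_def)
    also have "\<dots> = (\<Sum>j<?D. K * \<bar>f (z j)\<bar> powr p * (a * (\<integral>w. decay n (z j) w \<partial>surface_measure)))"
      by (simp add: sum_distrib_left mult_ac)
    also have "\<dots> \<le> (\<Sum>j<?D. K * \<bar>f (z j)\<bar> powr p * I)"
      using K nz I(2)[OF \<kappa>] unfolding n_def a_def by (intro sum_mono mult_left_mono) auto
    also have "\<dots> = K * I * (\<Sum>j<?D. \<bar>f (z j)\<bar> powr p)"
      by (simp add: sum_distrib_left mult_ac)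
    finally show "(real M + 1) ^ (CARD('n) - 1) * (\<integral>w. \<bar>f w\<bar> powr p \<partial>surface_measure)
        \<le> K * I * (\<Sum>j<?D. \<bar>f (z j)\<bar> powr p)" unfolding a_def .
  qed
qed

text \<open>
  Dually, each sample is bounded by a weighted mean of \<open>f\<close> with weight of bounded integral. After
  Jensen's inequality the weights are summed over the Fekete points, where the total weight at any
  point of the sphere is bounded by separation.
\<close>

lemma samples_le_sph_poly_Lp:
  fixes \<kappa> p :: real
  assumes "\<kappa> > 0" and p: "p \<ge> 1"
  obtains C where "C > 0"
    "\<And>L M z (f :: real ^ 'n \<Rightarrow> real). f \<in> sph_poly L \<Longrightarrow> L \<le> M \<Longrightarrow>
      real M + 1 \<le> \<kappa> * (real (M - L) + 1) \<Longrightarrow> fekete_points M z \<Longrightarrow>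
      (\<Sum>j<sph_dim TYPE('n) M. \<bar>f (z j)\<bar> powr p)
        \<le> C * (real M + 1) ^ (CARD('n) - 1) * (\<integral>x. \<bar>f x\<bar> powr p \<partial>surface_measure)"
proof -
  obtain C where C: "C > 0"
    "\<And>L M (f :: real ^ 'n \<Rightarrow> real) w. f \<in> sph_poly L \<Longrightarrow> L \<le> M \<Longrightarrow> norm w = 1 \<Longrightarrow>
      \<bar>f w\<bar> \<le> (\<integral>x. C * (real M + 1) ^ (CARD('n) - 1) * decay (real (M - L) + 1) w x * \<bar>f x\<bar> \<partial>surface_measure)"
    by (rule sph_poly_le_local_mean[where 'n = 'n]) (rule that; blast)
  obtain W where W: "W > 0"
    "\<And>L M z (w :: real ^ 'n). L \<le> M \<Longrightarrow> real M + 1 \<le> \<kappa> * (real (M - L) + 1) \<Longrightarrow>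
      fekete_points M z \<Longrightarrow> norm w = 1 \<Longrightarrow>
      (\<Sum>j<sph_dim TYPE('n) M. decay (real (M - L) + 1) w (z j)) \<le> W"
    by (rule fekete_total_weight_le[OF assms(1), where 'n = 'n]) (rule that; blast)
  obtain I where I: "I > 0"
    "\<And>L M (w :: real ^ 'n). real M + 1 \<le> \<kappa> * (real (M - L) + 1) \<Longrightarrow> norm w = 1 \<Longrightarrow>
      (real M + 1) ^ (CARD('n) - 1) * (\<integral>x. decay (real (M - L) + 1) w x \<partial>surface_measure) \<le> I"
    by (rule integral_decay_scaled_le[OF assms(1), where 'n = 'n]) (rule that; blast)
  define K where "K = (C * I) powr (p - 1) * C"
  have K: "K > 0" using C I by (simp add: K_def)
  show thesis
  proof (rule that[of "K * W"])
    show "K * W > 0" using K W by simp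
    fix L M and z :: "nat \<Rightarrow> real ^ 'n" and f :: "real ^ 'n \<Rightarrow> real"
    assume f: "f \<in> sph_poly L" and LM: "L \<le> M" and \<kappa>: "real M + 1 \<le> \<kappa> * (real (M - L) + 1)"
      and z: "fekete_points M z"
    define n where "n = real (M - L) + 1"
    define a where "a = (real M + 1) ^ (CARD('n) - 1)"
    let ?D = "sph_dim TYPE('n) M"
    have n0: "n \<ge> 0" by (simp add: n_def)
    have a: "a > 0" by (simp add: a_def)
    have nz: "norm (z j) = 1" if "j < ?D" for j
      using z that unfolding fekete_points_def by auto
    have int_p: "integrable surface_measure (\<lambda>x. decay n w x * \<bar>f x\<bar> powr p)" for w
      using f n0 p by (intro integrable_decay_powr) auto
    have pt: "\<bar>f w\<bar> powr p \<le> K * a * (\<integral>x. decay n w x * \<bar>f x\<bar> powr p \<partial>surface_measure)" if w: "norm w = 1" for w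
    proof -
      have "\<bar>f w\<bar> powr p \<le> (\<integral>x. C * a * decay n w x * \<bar>f x\<bar> \<partial>surface_measure) powr p"
        using C(2)[OF f LM w] p unfolding n_def a_def by (intro powr_mono2) auto
      also have "\<dots> \<le> (C * I) powr (p - 1) * (\<integral>x. C * a * decay n w x * \<bar>f x\<bar> powr p \<partial>surface_measure)"
      proof (rule weighted_jensen_powr[OF p])
        show "(\<integral>x. C * a * decay n w x \<partial>surface_measure) \<le> C * I"
          using mult_left_mono[OF I(2)[OF \<kappa> w], of C] C(1) unfolding n_def a_def
          by (simp add: mult.assoc)
        show "integrable surface_measure (\<lambda>x. C * a * decay n w x * \<bar>f x\<bar>)"
          unfolding mult.assoc using f n0
          by (intro integrable_mult_right integrable_decay_abs)
        show "integrable surface_measure (\<lambda>x. C * a * decay n w x * \<bar>f x\<bar> powr p)"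
          unfolding mult.assoc by (intro integrable_mult_right int_p)
      qed (use C(1) I(1) a n0 in \<open>auto intro!: integrable_decay simp: less_imp_le[OF decay_pos]\<close>)
      also have "\<dots> = K * a * (\<integral>x. decay n w x * \<bar>f x\<bar> powr p \<partial>surface_measure)"
        by (simp add: K_def mult.assoc)
      finally show ?thesis .
    qed
    have "(\<Sum>j<?D. \<bar>f (z j)\<bar> powr p) \<le> (\<Sum>j<?D. K * a * (\<integral>x. decay n (z j) x * \<bar>f x\<bar> powr p \<partial>surface_measure))"
      using nz by (intro sum_mono pt) auto
    also have "\<dots> = K * a * (\<integral>x. (\<Sum>j<?D. decay n (z j) x * \<bar>f x\<bar> powr p) \<partial>surface_measure)"
      using int_p by (subst Bochner_Integration.integral_sum) (auto simp: sum_distrib_left)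
    also have "\<dots> \<le> K * a * (\<integral>x. W * \<bar>f x\<bar> powr p \<partial>surface_measure)"
    proof (intro mult_left_mono integral_mono)
      fix x :: "real ^ 'n" assume "x \<in> space surface_measure"
      then have "(\<Sum>j<?D. decay n x (z j)) \<le> W"
        unfolding n_def by (intro W(2)[OF LM \<kappa> z]) (simp add: space_surface_measure)
      then show "(\<Sum>j<?D. decay n (z j) x * \<bar>f x\<bar> powr p) \<le> W * \<bar>f x\<bar> powr p"
        unfolding sum_distrib_right[symmetric] decay_commute[of n _ x] by (intro mult_right_mono) auto
    qed (use f p K a in \<open>auto intro!: int_p integrable_mult_right integrable_sph_poly_powr\<close>)
    also have "\<dots> = K * W * a * (\<integral>x. \<bar>f x\<bar> powr p \<partial>surface_measure)"
      by (simp add: mult_ac)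
    finally show "(\<Sum>j<?D. \<bar>f (z j)\<bar> powr p)
        \<le> K * W * (real M + 1) ^ (CARD('n) - 1) * (\<integral>x. \<bar>f x\<bar> powr p \<partial>surface_measure)"
      unfolding a_def .
  qed
qed

section \<open>The Marcinkiewicz-Zygmund property\<close>

lemma L_eps_ge:
  assumes "\<epsilon> > 0"
  shows "L \<le> L_eps \<epsilon> L"
proof -
  have "real L \<le> (1 + \<epsilon>) * real L" using assms by (simp add: algebra_simps)
  then have "\<lfloor>real L\<rfloor> \<le> \<lfloor>(1 + \<epsilon>) * real L\<rfloor>" by (rule floor_mono)
  then show ?thesis unfolding L_eps_def by simp
qed

lemma L_eps_le:
  assumes "\<epsilon> > 0"
  shows "real (L_eps \<epsilon> L) \<le> (1 + \<epsilon>) * real L"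
  unfolding L_eps_def using assms by (simp add: of_nat_nat)

text \<open>
  Since \<open>L\<^sub>\<epsilon> > (1 + \<epsilon>) L - 1\<close>, the gap \<open>m = L\<^sub>\<epsilon> - L\<close> satisfies \<open>\<epsilon> L \<le> m + 1\<close>, hence
  \<open>L\<^sub>\<epsilon> + 1 \<le> (1 + \<epsilon>) L + 1\<close> is at most \<open>(1 + \<epsilon>)/\<epsilon> (m + 1) + 1\<close>. Working with \<open>m + 1\<close> instead of
  \<open>m\<close> covers the small degrees, where the gap may vanish, with the same constant.
\<close>

lemma L_eps_gap:
  assumes "\<epsilon> > 0"
  shows "real (L_eps \<epsilon> L) + 1 \<le> ((1 + \<epsilon>) / \<epsilon> + 1) * (real (L_eps \<epsilon> L - L) + 1)"
proof -
  define m where "m = real (L_eps \<epsilon> L - L)"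
  have "real (L_eps \<epsilon> L) > (1 + \<epsilon>) * real L - 1"
    unfolding L_eps_def using assms by (simp add: of_nat_nat)
  then have "\<epsilon> * real L \<le> m + 1"
    using L_eps_ge[OF assms, of L] by (simp add: m_def of_nat_diff algebra_simps)
  then have "(1 + \<epsilon>) / \<epsilon> * (\<epsilon> * real L) \<le> (1 + \<epsilon>) / \<epsilon> * (m + 1)"
    using assms by (intro mult_left_mono) auto
  moreover have "(1 + \<epsilon>) / \<epsilon> * (\<epsilon> * real L) = (1 + \<epsilon>) * real L"
    using assms by simp
  moreover have "real (L_eps \<epsilon> L) \<le> (1 + \<epsilon>) * real L" by (rule L_eps_le[OF assms])
  moreover have "((1 + \<epsilon>) / \<epsilon> + 1) * (m + 1) = (1 + \<epsilon>) / \<epsilon> * (m + 1) + m + 1"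
    by (simp add: algebra_simps)
  moreover have "m \<ge> 0" by (simp add: m_def)
  ultimately show ?thesis unfolding m_def[symmetric] by linarith
qed

text \<open>
  Separation makes the points distinct. Their number grows at least like the power \<open>d\<close> of the
  degree, which is unbounded as \<open>d \<ge> 1\<close>.
\<close>

lemma fekete_triangular_array:
  fixes z :: "nat \<Rightarrow> nat \<Rightarrow> real ^ 'n"
  assumes card: "CARD('n) \<ge> 2" and z: "\<And>L. fekete_points L (z L)" and h: "\<And>L. L \<le> h L"
  shows "triangular_array (\<lambda>L. sph_dim TYPE('n) (h L)) (\<lambda>L. z (h L))"
  unfolding triangular_array_def
proof (intro conjI allI)
  fix L
  show "inj_on (z (h L)) {..<sph_dim TYPE('n) (h L)}"
  proof (rule inj_onI, rule ccontr)
    fix i j assume "i \<in> {..<sph_dim TYPE('n) (h L)}" "j \<in> {..<sph_dim TYPE('n) (h L)}"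
      "z (h L) i = z (h L) j" "i \<noteq> j"
    with fekete_separated[OF z, of i "h L" j] show False by (simp add: divide_le_0_iff)
  qed
  show "z (h L) ` {..<sph_dim TYPE('n) (h L)} \<subseteq> sphere 0 1"
    using z[of "h L"] unfolding fekete_points_def by auto
next
  obtain c where c: "c > 0" "\<And>M (z :: nat \<Rightarrow> real ^ 'n). fekete_points M z \<Longrightarrow>
      c * (real M + 1) ^ (CARD('n) - 1) \<le> real (sph_dim TYPE('n) M)"
    by (rule sph_dim_lower[where 'n = 'n]) (rule that; blast)
  have "filterlim (\<lambda>L. c * real L) at_top sequentially"
    using c(1) filterlim_real_sequentially by (intro filterlim_tendsto_pos_mult_at_top[OF tendsto_const])
  then show "filterlim (\<lambda>L. sph_dim TYPE('n) (h L)) at_top sequentially"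
    unfolding filterlim_sequentially_iff_filterlim_real
  proof (rule filterlim_at_top_mono, intro always_eventually allI)
    fix L
    have "real L \<le> real (h L) + 1" using h[of L] by simp
    also have "\<dots> \<le> (real (h L) + 1) ^ (CARD('n) - 1)"
      using card by (intro self_le_power) auto
    finally have "c * real L \<le> c * (real (h L) + 1) ^ (CARD('n) - 1)"
      using c(1) by simp
    also have "\<dots> \<le> real (sph_dim TYPE('n) (h L))" by (rule c(2)[OF z])
    finally show "c * real L \<le> real (sph_dim TYPE('n) (h L))" .
  qed
qed

theorem theorem2p1:
  fixes d :: nat and z :: "nat \<Rightarrow> nat \<Rightarrow> real ^ 'n" and \<epsilon> :: real
  assumes "d \<ge> 1" and "CARD('n) = d + 1"
    and "\<And>L. fekete_points L (z L)"
    and "\<epsilon> > 0"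
  shows "\<forall>p :: ennreal. 1 \<le> p \<longrightarrow>
    MZ_array p (\<lambda>L. sph_dim TYPE('n) (L_eps \<epsilon> L)) (\<lambda>L. z (L_eps \<epsilon> L))"
proof (intro allI impI)
  fix p :: ennreal assume p: "1 \<le> p"
  note z = assms(3)
  define \<kappa> where "\<kappa> = (1 + \<epsilon>) / \<epsilon> + 1"
  have \<kappa>: "\<kappa> > 0" using assms(4) by (simp add: \<kappa>_def add_pos_pos)
  define M where "M = L_eps \<epsilon>"
  have LM: "L \<le> M L" for L unfolding M_def by (rule L_eps_ge[OF assms(4)])
  have gap: "real (M L) + 1 \<le> \<kappa> * (real (M L - L) + 1)" for L
    unfolding M_def \<kappa>_def by (rule L_eps_gap[OF assms(4)])
  have tri: "triangular_array (\<lambda>L. sph_dim TYPE('n) (M L)) (\<lambda>L. z (M L))"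
    using assms(1,2) by (intro fekete_triangular_array z LM) auto
  have dim: "sph_dim TYPE('n) L \<le> sph_dim TYPE('n) (M L)" for L
    by (rule sph_dim_mono[OF z z LM])
  obtain c where c: "c > 0" "\<And>M (z :: nat \<Rightarrow> real ^ 'n). fekete_points M z \<Longrightarrow>
      c * (real M + 1) ^ (CARD('n) - 1) \<le> real (sph_dim TYPE('n) M)"
    by (rule sph_dim_lower[where 'n = 'n]) (rule that; blast)
  obtain D where D: "D > 0" "\<And>M (z :: nat \<Rightarrow> real ^ 'n). fekete_points M z \<Longrightarrow>
      real (sph_dim TYPE('n) M) \<le> D * (real M + 1) ^ (CARD('n) - 1)"
    by (rule sph_dim_upper[where 'n = 'n]) (rule that; blast)
  have pos: "sph_dim TYPE('n) L > 0" for L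
  proof -
    have "0 < c * (real L + 1) ^ (CARD('n) - 1)" using c(1) by simp
    also have "\<dots> \<le> real (sph_dim TYPE('n) L)" by (rule c(2)[OF z])
    finally show ?thesis by simp
  qed
  show "MZ_array p (\<lambda>L. sph_dim TYPE('n) (L_eps \<epsilon> L)) (\<lambda>L. z (L_eps \<epsilon> L))"
    unfolding M_def[symmetric]
  proof (cases "p = \<infinity>")
    case True
    obtain C where C: "C > 0"
      "\<And>L M z (f :: real ^ 'n \<Rightarrow> real) w B. f \<in> sph_poly L \<Longrightarrow> L \<le> M \<Longrightarrow>
        real M + 1 \<le> \<kappa> * (real (M - L) + 1) \<Longrightarrow> fekete_points M z \<Longrightarrow> norm w = 1 \<Longrightarrow> 0 \<le> B \<Longrightarrow>
        (\<And>j. j < sph_dim TYPE('n) M \<Longrightarrow> \<bar>f (z j)\<bar> \<le> B) \<Longrightarrow> \<bar>f w\<bar> \<le> C * B"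
      by (rule sph_poly_sup_le_samples[OF \<kappa>, where 'n = 'n]) (rule that; blast)
    have "(SUP \<omega>\<in>sphere 0 1. \<bar>Q \<omega>\<bar>) \<le> C * (SUP j\<in>{..<sph_dim TYPE('n) (M L)}. \<bar>Q (z (M L) j)\<bar>)"
      if Q: "Q \<in> sph_poly L" for L and Q :: "real ^ 'n \<Rightarrow> real"
    proof (rule cSUP_least)
      show "sphere (0 :: real ^ 'n) 1 \<noteq> {}" using unit_vector_exists by auto
      fix \<omega> :: "real ^ 'n" assume "\<omega> \<in> sphere 0 1"
      have le: "\<bar>Q (z (M L) j)\<bar> \<le> (SUP j\<in>{..<sph_dim TYPE('n) (M L)}. \<bar>Q (z (M L) j)\<bar>)"
        if "j < sph_dim TYPE('n) (M L)" for j
        using that by (intro cSUP_upper) auto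
      show "\<bar>Q \<omega>\<bar> \<le> C * (SUP j\<in>{..<sph_dim TYPE('n) (M L)}. \<bar>Q (z (M L) j)\<bar>)"
        using \<open>\<omega> \<in> sphere 0 1\<close> order_trans[OF abs_ge_zero le[OF pos]]
        by (intro C(2)[OF Q LM gap z _ _ le]) auto
    qed
    with C(1) tri dim True show "MZ_array p (\<lambda>L. sph_dim TYPE('n) (M L)) (\<lambda>L. z (M L))"
      unfolding MZ_array_def by auto
  next
    case False
    define q where "q = enn2real p"
    have "enn2real 1 \<le> enn2real p"
      using p False by (intro enn2real_mono) (auto simp: less_top)
    then have q: "q \<ge> 1" by (simp add: q_def)
    obtain A where A: "A > 0"
      "\<And>L M z (f :: real ^ 'n \<Rightarrow> real). f \<in> sph_poly L \<Longrightarrow> L \<le> M \<Longrightarrow>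
        real M + 1 \<le> \<kappa> * (real (M - L) + 1) \<Longrightarrow> fekete_points M z \<Longrightarrow>
        (real M + 1) ^ (CARD('n) - 1) * (\<integral>w. \<bar>f w\<bar> powr q \<partial>surface_measure)
          \<le> A * (\<Sum>j<sph_dim TYPE('n) M. \<bar>f (z j)\<bar> powr q)"
      by (rule sph_poly_Lp_le_samples[OF \<kappa> q, where 'n = 'n]) (rule that; blast)
    obtain B where B: "B > 0"
      "\<And>L M z (f :: real ^ 'n \<Rightarrow> real). f \<in> sph_poly L \<Longrightarrow> L \<le> M \<Longrightarrow>
        real M + 1 \<le> \<kappa> * (real (M - L) + 1) \<Longrightarrow> fekete_points M z \<Longrightarrow>
        (\<Sum>j<sph_dim TYPE('n) M. \<bar>f (z j)\<bar> powr q)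
          \<le> B * (real M + 1) ^ (CARD('n) - 1) * (\<integral>x. \<bar>f x\<bar> powr q \<partial>surface_measure)"
      by (rule samples_le_sph_poly_Lp[OF \<kappa> q, where 'n = 'n]) (rule that; blast)
    \<comment> \<open>The factor \<open>(1 + \<epsilon>)\<^sup>d / c\<close> converts \<open>(L\<^sub>\<epsilon> + 1)\<^sup>d\<close> into the dimension in degree \<open>L\<close>.\<close>
    define B' where "B' = B * (1 + \<epsilon>) ^ (CARD('n) - 1) / c"
    define C where "C = max (D * A) B'"
    have C: "C > 0" using D(1) A(1) by (simp add: C_def less_max_iff_disj)
    have "inverse C / real (sph_dim TYPE('n) L) * (\<Sum>j<sph_dim TYPE('n) (M L). \<bar>Q (z (M L) j)\<bar> powr q)
            \<le> (\<integral>\<omega>. \<bar>Q \<omega>\<bar> powr q \<partial>surface_measure) \<and>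
          (\<integral>\<omega>. \<bar>Q \<omega>\<bar> powr q \<partial>surface_measure)
            \<le> C / real (sph_dim TYPE('n) L) * (\<Sum>j<sph_dim TYPE('n) (M L). \<bar>Q (z (M L) j)\<bar> powr q)"
      if Q: "Q \<in> sph_poly L" for L and Q :: "real ^ 'n \<Rightarrow> real"
    proof -
      define S where "S = (\<Sum>j<sph_dim TYPE('n) (M L). \<bar>Q (z (M L) j)\<bar> powr q)"
      define I where "I = (\<integral>\<omega>. \<bar>Q \<omega>\<bar> powr q \<partial>surface_measure)"
      define \<pi>L where "\<pi>L = real (sph_dim TYPE('n) L)"
      define a where "a = (real (M L) + 1) ^ (CARD('n) - 1)"
      have S0: "S \<ge> 0" unfolding S_def by (intro sum_nonneg) auto
      have I0: "I \<ge> 0" unfolding I_def by (intro integral_nonneg_AE AE_I2) auto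
      have \<pi>0: "\<pi>L > 0" using pos[of L] by (simp add: \<pi>L_def)
      have "\<pi>L \<le> D * a"
      proof -
        have "\<pi>L \<le> real (sph_dim TYPE('n) (M L))" using dim[of L] by (simp add: \<pi>L_def)
        also have "\<dots> \<le> D * a" unfolding a_def by (rule D(2)[OF z])
        finally show ?thesis .
      qed
      then have "\<pi>L * I \<le> D * a * I" using I0 by (rule mult_right_mono)
      also have "\<dots> = D * (a * I)" by simp
      also have "\<dots> \<le> D * (A * S)"
        using D(1) unfolding a_def I_def S_def by (intro mult_left_mono A(2)[OF Q LM gap z]) auto
      also have "\<dots> \<le> C * S"
        using S0 unfolding C_def mult.assoc[symmetric] by (intro mult_right_mono) auto
      finally have up: "I \<le> C / \<pi>L * S" using \<pi>0 by (simp add: field_simps)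
      have "a \<le> (1 + \<epsilon>) ^ (CARD('n) - 1) / c * \<pi>L"
      proof -
        have "real (M L) + 1 \<le> (1 + \<epsilon>) * (real L + 1)"
          using L_eps_le[OF assms(4), of L] assms(4) unfolding M_def by (simp add: algebra_simps)
        then have "a \<le> ((1 + \<epsilon>) * (real L + 1)) ^ (CARD('n) - 1)"
          unfolding a_def by (intro power_mono) auto
        also have "\<dots> = (1 + \<epsilon>) ^ (CARD('n) - 1) / c * (c * (real L + 1) ^ (CARD('n) - 1))"
          using c(1) by (simp add: power_mult_distrib)
        also have "\<dots> \<le> (1 + \<epsilon>) ^ (CARD('n) - 1) / c * \<pi>L"
          unfolding \<pi>L_def using c(1) assms(4) by (intro mult_left_mono c(2)[OF z]) auto
        finally show ?thesis .
      qed
      then have "B * a * I \<le> B * ((1 + \<epsilon>) ^ (CARD('n) - 1) / c * \<pi>L) * I"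
        using B(1) I0 by (intro mult_right_mono mult_left_mono) auto
      moreover have "S \<le> B * a * I"
        unfolding S_def a_def I_def by (rule B(2)[OF Q LM gap z])
      ultimately have "S \<le> B' * (\<pi>L * I)" by (simp add: B'_def mult_ac)
      also have "\<dots> \<le> C * (\<pi>L * I)"
        using \<pi>0 I0 unfolding C_def by (intro mult_right_mono) auto
      finally have "inverse C / \<pi>L * S \<le> I" using C \<pi>0 by (simp add: field_simps)
      with up show ?thesis unfolding S_def I_def \<pi>L_def by blast
    qed
    with C tri dim False show "MZ_array p (\<lambda>L. sph_dim TYPE('n) (M L)) (\<lambda>L. z (M L))"
      unfolding MZ_array_def q_def by auto
  qed
qed

end
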